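(* Let $\beta>-2$ and let $n\ge 2$ be an integer. Then the following hold. (i) For every $t\ge 0$, $\mathsf P(D_n>t)=\mathsf E\bigl(F_n(\xi_t)\bigr)$; moreover $\mathsf E D_n=\mathcal U_\beta F_n$ and $\mathsf E\Lambda_n=\mathcal U_\beta H_n$. (ii) $\mathsf E L_n=\sum_{j=2}^n a_\beta(n,j)$, where for $2\le j\le n$ $$a_\beta(n,j)=\phi_\beta(j-1)\binom{n-1}{j-1}\,\mathcal U_\beta G_{n,j}.$$ (iii) Let $M_{n-1}$ be the maximum of $n-1$ independent exponential random variables of rate $1$, independent of $\xi$. Then $$D_n\stackrel{d}{=}T_{M_{n-1}},\qquad\text{where } T_x:=\inf\{t\ge 0:\xi_t\ge x\}.$$
   Context: For $\beta>-2$ put $$\phi_\beta(z)=\int_0^1(1-s^z)s^{\beta+1}(1-s)^\beta\,ds,\qquad \operatorname{Re}z\ge 0,$$ and let $\xi=(\xi_t)_{t\ge0}$ be the subordinator with $\mathsf E e^{-z\xi_t}=e^{-t\phi_\beta(z)}$. Let $B$ denote the beta function, $B(a,b)=\Gamma(a)\Gamma(b)/\Gamma(a+b)$. Continuous-time beta-splitting tree on $n$ leaves: a continuous-time Markov chain $\Pi_n$ on partitions of $[n]=\{1,\dots,n\}$ started from the one-block partition, in which different blocks evolve independently, singletons are absorbing, and a block containing $m\ge2$ labels waits an exponential time of rate $\phi_\beta(m-1)$ and then splits into an ordered pair of nonempty blocks; the first has size $i$, $1\le i\le m-1$, with probability $$q_\beta(m,i)=\frac{1}{2\phi_\beta(m-1)}\binom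 mi B(i+\beta+1,m-i+\beta+1),$$ and, given $i$, the set of labels of the first block is uniform among subsets of size $i$. (Equivalently, $\Pi_n$ is the restriction to $[n]$ of the conservative binary homogeneous exchangeable fragmentation of $\mathbb N$ without erosion and with dislocation measure $\nu_\beta(dx)=x^\beta(1-x)^\beta dx$ on $[1/2,1)$; if $\Pi_1(t)$ is the block of label $1$ in that fragmentation, its asymptotic frequency is $|\Pi_1(t)|=e^{-\xi_t}$.) The singletons are the leaves. $D_n$ is the continuous height of a uniformly chosen leaf, i.e. the first time it is a singleton block; $L_n$ is its discrete height, i.e. the number of splits of blocks containing it before it becomes a singleton; $a_\beta(n,j)$ is the probability that the block (clade) containing this leaf ever has size exactly $j$; $\Lambda_n$ is the total continuous length of the tree, $\Lambda_n=\int_0^\infty\#\{\text{non-singleton blocks of }\Pi_n(t)\}\,dt$. Potential operator: for nonnegative Borel $f$ on $[0,\infty)$, $$\mathcal U_\beta f:=\mathsf E\Bigl[\int_0^\infty f(\xi_t)\,dt\Bigr].$$ For $n\ge2$, $2\le j\le n$ and $x\ge0$ (with $0^0=1$), $$F_n(x)=1-(1-e^{-x})^{n-1},\quad G_{n,j}(x)=e^{-(j-1)x}(1-e^{-x})^{n-j},\quad H_n(x)=e^x\bigl[1-(1-e^{-x})^n\bigr]-n(1-e^{-x})^{n-1}.$$ *)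

theory Defs
  imports "HOL-Probability.Probability" "HOL-Library.Disjoint_Sets"
begin

text \<open>Used below both at complex arguments (Laplace exponent) and at real ones (split rates).\<close>

definition phi :: "real \<Rightarrow> 'a \<Rightarrow> 'a::{banach, second_countable_topology, real_normed_field, ln}" where
  "phi \<beta> z = (LINT s:{0<..<1}|lborel.
      (1 - of_real s powr z) * of_real (s powr (\<beta> + 1) * (1 - s) powr \<beta>))"

definition split_size_prob :: "real \<Rightarrow> nat \<Rightarrow> nat \<Rightarrow> real" where
  "split_size_prob \<beta> m i =
     1 / (2 * phi \<beta> (real m - 1)) * real (m choose i) * Beta (real i + \<beta> + 1) (real m - real i + \<beta> + 1)"


section \<open>Finite-state continuous-time Markov chains\<close>

primrec matrix_pow :: "'s set \<Rightarrow> ('s \<Rightarrow> 's \<Rightarrow> real) \<Rightarrow> nat \<Rightarrow> 's \<Rightarrow> 's \<Rightarrow> real" where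
  "matrix_pow S Q 0 x y = (if x = y then 1 else 0)"
| "matrix_pow S Q (Suc k) x y = (\<Sum>z\<in>S. Q x z * matrix_pow S Q k z y)"

text \<open>The entries of the matrix exponential of \<open>t Q\<close>.\<close>

definition transition_prob :: "'s set \<Rightarrow> ('s \<Rightarrow> 's \<Rightarrow> real) \<Rightarrow> real \<Rightarrow> 's \<Rightarrow> 's \<Rightarrow> real" where
  "transition_prob S Q t x y = (\<Sum>k. t ^ k / fact k * matrix_pow S Q k x y)"

text \<open>Right-continuity of the paths is with respect to the discrete topology on \<open>S\<close>.
  The processes below are indexed by \<open>real\<close>, but only times \<open>t \<ge> 0\<close> matter.\<close>

definition finite_ctmc ::
    "'w measure \<Rightarrow> 's set \<Rightarrow> ('s \<Rightarrow> 's \<Rightarrow> real) \<Rightarrow> 's \<Rightarrow> (real \<Rightarrow> 'w \<Rightarrow> 's) \<Rightarrow> bool" where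
  "finite_ctmc M S Q x0 X \<longleftrightarrow>
     prob_space M \<and> finite S \<and>
     (\<forall>t\<ge>0. X t \<in> measurable M (count_space S)) \<and>
     (\<forall>\<omega>\<in>space M. \<forall>t\<ge>0. \<forall>\<^sub>F s in at_right t. X s \<omega> = X t \<omega>) \<and>
     (AE \<omega> in M. X 0 \<omega> = x0) \<and>
     (\<forall>(k::nat) \<tau> x t y.
        0 \<le> \<tau> 0 \<and> (\<forall>i<k. \<tau> i \<le> \<tau> (Suc i)) \<and> \<tau> k \<le> t \<and> (\<forall>i\<le>k. x i \<in> S) \<and> y \<in> S \<longrightarrow>
        measure M {\<omega>\<in>space M. (\<forall>i\<le>k. X (\<tau> i) \<omega> = x i) \<and> X t \<omega> = y} =
        measure M {\<omega>\<in>space M. \<forall>i\<le>k. X (\<tau> i) \<omega> = x i} * transition_prob S Q (t - \<tau> k) (x k) y)"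


section \<open>The beta-splitting tree\<close>

definition label_partitions :: "nat \<Rightarrow> nat set set set" where
  "label_partitions n = {\<pi>. partition_on {1..n} \<pi>}"

definition split_block :: "nat set set \<Rightarrow> nat set \<Rightarrow> nat set \<Rightarrow> nat set set" where
  "split_block \<pi> A S = (\<pi> - {A}) \<union> {S, A - S}"

text \<open>Jump rates: independently of the other blocks, a block \<open>A\<close> with \<open>m \<ge> 2\<close> labels splits at
  rate \<open>phi \<beta> (m - 1)\<close> into the ordered pair \<open>(S, A - S)\<close>, where \<open>card S = i\<close> has probability
  \<open>split_size_prob \<beta> m i\<close> and \<open>S\<close> is uniform among the \<open>m choose i\<close> subsets of that size. A
  partition forgets the order of the pair, so two choices of \<open>S\<close> contribute to the same jump.\<close>

definition splitting_rate :: "real \<Rightarrow> nat set set \<Rightarrow> nat set set \<Rightarrow> real" where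
  "splitting_rate \<beta> \<pi> \<rho> =
     (if \<rho> = \<pi> then - (\<Sum>A\<in>{A\<in>\<pi>. 2 \<le> card A}. phi \<beta> (real (card A) - 1))
      else (\<Sum>(A, S)\<in>{(A, S). A \<in> \<pi> \<and> 2 \<le> card A \<and> S \<noteq> {} \<and> S \<subset> A \<and> split_block \<pi> A S = \<rho>}.
              phi \<beta> (real (card A) - 1) *
              (split_size_prob \<beta> (card A) (card S) / real (card A choose card S))))"

definition beta_splitting_tree :: "real \<Rightarrow> nat \<Rightarrow> 'w measure \<Rightarrow> (real \<Rightarrow> 'w \<Rightarrow> nat set set) \<Rightarrow> bool" where
  "beta_splitting_tree \<beta> n M X \<longleftrightarrow>
     finite_ctmc M (label_partitions n) (splitting_rate \<beta>) {{1..n}} X"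

text \<open>Independence of two random elements with possibly different value types.\<close>

definition indep_elements ::
    "'w measure \<Rightarrow> 'a measure \<Rightarrow> ('w \<Rightarrow> 'a) \<Rightarrow> 'b measure \<Rightarrow> ('w \<Rightarrow> 'b) \<Rightarrow> bool" where
  "indep_elements M A X B Y \<longleftrightarrow>
     X \<in> measurable M A \<and> Y \<in> measurable M B \<and>
     prob_space.indep_set M (sets (vimage_algebra (space M) X A)) (sets (vimage_algebra (space M) Y B))"

definition uniform_leaf ::
    "nat \<Rightarrow> 'w measure \<Rightarrow> (real \<Rightarrow> 'w \<Rightarrow> nat set set) \<Rightarrow> ('w \<Rightarrow> nat) \<Rightarrow> bool" where
  "uniform_leaf n M X U \<longleftrightarrow>
     distr M (count_space UNIV) U = measure_pmf (pmf_of_set {1..n}) \<and>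
     indep_elements M (count_space UNIV) U
       (\<Pi>\<^sub>M t\<in>{0..}. count_space (label_partitions n)) (\<lambda>\<omega>. \<lambda>t\<in>{0..}. X t \<omega>)"

definition block_of :: "nat set set \<Rightarrow> nat \<Rightarrow> nat set" where
  "block_of \<pi> u = (THE A. A \<in> \<pi> \<and> u \<in> A)"

text \<open>In the following three definitions \<open>p\<close> is a single path. The height is infinite if the leaf
  never becomes a singleton.\<close>

definition cont_height :: "(real \<Rightarrow> nat set set) \<Rightarrow> nat \<Rightarrow> ennreal" where
  "cont_height p u = (INF t\<in>{t. 0 \<le> t \<and> {u} \<in> p t}. ennreal t)"

text \<open>The splits of the blocks containing \<open>u\<close> occur at the times at which the block of \<open>u\<close> differs
  from its left limit; almost surely there are only finitely many of them.\<close>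

definition discrete_height :: "(real \<Rightarrow> nat set set) \<Rightarrow> nat \<Rightarrow> nat" where
  "discrete_height p u =
     card {t. 0 < t \<and> ennreal t \<le> cont_height p u \<and>
              \<not> (\<forall>\<^sub>F s in at_left t. block_of (p s) u = block_of (p t) u)}"

definition total_length :: "(real \<Rightarrow> nat set set) \<Rightarrow> ennreal" where
  "total_length p = (\<integral>\<^sup>+t\<in>{0..}. of_nat (card {A\<in>p t. card A \<noteq> 1}) \<partial>lborel)"

definition clade_prob :: "'w measure \<Rightarrow> (real \<Rightarrow> 'w \<Rightarrow> nat set set) \<Rightarrow> ('w \<Rightarrow> nat) \<Rightarrow> nat \<Rightarrow> real" where
  "clade_prob M X U j = measure M {\<omega>\<in>space M. \<exists>t\<ge>0. card (block_of (X t \<omega>) (U \<omega>)) = j}"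


section \<open>The subordinator\<close>

definition subordinator :: "'v measure \<Rightarrow> (real \<Rightarrow> 'v \<Rightarrow> real) \<Rightarrow> bool" where
  "subordinator N \<xi> \<longleftrightarrow>
     prob_space N \<and>
     (\<forall>t\<ge>0. \<xi> t \<in> borel_measurable N) \<and>
     (\<forall>\<omega>\<in>space N. \<xi> 0 \<omega> = 0 \<and> mono_on {0..} (\<lambda>t. \<xi> t \<omega>) \<and>
        (\<forall>t\<ge>0. continuous (at_right t) (\<lambda>t. \<xi> t \<omega>))) \<and>
     (\<forall>s\<ge>0. \<forall>t\<ge>0. distr N borel (\<lambda>\<omega>. \<xi> (s + t) \<omega> - \<xi> s \<omega>) = distr N borel (\<xi> t)) \<and>
     (\<forall>(\<tau>::nat \<Rightarrow> real) k. 0 \<le> \<tau> 0 \<and> mono \<tau> \<longrightarrow>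
        prob_space.indep_vars N (\<lambda>_. borel) (\<lambda>i \<omega>. \<xi> (\<tau> (Suc i)) \<omega> - \<xi> (\<tau> i) \<omega>) {..<k})"

definition beta_subordinator :: "real \<Rightarrow> 'v measure \<Rightarrow> (real \<Rightarrow> 'v \<Rightarrow> real) \<Rightarrow> bool" where
  "beta_subordinator \<beta> N \<xi> \<longleftrightarrow>
     subordinator N \<xi> \<and>
     (\<forall>t\<ge>0. \<forall>z::complex. 0 \<le> Re z \<longrightarrow>
        (LINT \<omega>|N. exp (- z * of_real (\<xi> t \<omega>))) = exp (- of_real t * phi \<beta> z))"

definition potential :: "'v measure \<Rightarrow> (real \<Rightarrow> 'v \<Rightarrow> real) \<Rightarrow> (real \<Rightarrow> real) \<Rightarrow> ennreal" where
  "potential N \<xi> f = (\<integral>\<^sup>+\<omega>. (\<integral>\<^sup>+t\<in>{0..}. ennreal (f (\<xi> t \<omega>)) \<partial>lborel) \<partial>N)"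

definition F_fun :: "nat \<Rightarrow> real \<Rightarrow> real" where
  "F_fun n x = 1 - (1 - exp (- x)) ^ (n - 1)"

definition G_fun :: "nat \<Rightarrow> nat \<Rightarrow> real \<Rightarrow> real" where
  "G_fun n j x = exp (- (real j - 1) * x) * (1 - exp (- x)) ^ (n - j)"

definition H_fun :: "nat \<Rightarrow> real \<Rightarrow> real" where
  "H_fun n x = exp x * (1 - (1 - exp (- x)) ^ n) - real n * (1 - exp (- x)) ^ (n - 1)"

definition passage_time :: "(real \<Rightarrow> real) \<Rightarrow> real \<Rightarrow> ennreal" where
  "passage_time p x = (INF t\<in>{t. 0 \<le> t \<and> x \<le> p t}. ennreal t)"

text \<open>Measurability is part of the notion, since \<open>distr\<close> is degenerate for non-measurable maps.\<close>

definition same_law :: "'w measure \<Rightarrow> ('w \<Rightarrow> ennreal) \<Rightarrow> 'v measure \<Rightarrow> ('v \<Rightarrow> ennreal) \<Rightarrow> bool" where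
  "same_law M X N Y \<longleftrightarrow>
     X \<in> borel_measurable M \<and> Y \<in> borel_measurable N \<and> distr M borel X = distr N borel Y"

end

theory Submission
  imports Defs
begin

text \<open>The proof rests on one eigenvector computation. Call a partition \<open>\<pi>\<close> good for a label set \<open>V\<close>
if some block of \<open>\<pi>\<close> contains \<open>V\<close> (\<open>together V \<pi>\<close>). A block \<open>A \<supseteq> V\<close> is split by
first drawing \<open>s\<close> from the (possibly infinite) measure \<open>s\<^sup>\<beta> (1 - s)\<^sup>\<beta> ds / 2\<close> and then sending
every label independently to the first part with probability \<open>s\<close>. The labels outside \<open>V\<close> therefore
have no influence on whether \<open>V\<close> is separated, and the rate of separation is
\<open>1/2 \<integral> (1 - s\<^sup>k - (1 - s)\<^sup>k) s\<^sup>\<beta> (1 - s)\<^sup>\<beta> ds = phi \<beta> (k - 1)\<close> with \<open>k = card V\<close>, for every block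
\<open>A\<close> (\<open>separating_rate\<close>). Hence the indicator of \<open>together V\<close> is an eigenvector of the generator with
eigenvalue \<open>- phi \<beta> (k - 1)\<close> (\<open>splitting_rate_eigenvector\<close>), and it decays by the factor
\<open>exp (- t * phi \<beta> (k - 1))\<close> in time \<open>t\<close>, also conditionally on the present
(\<open>prob_together_Markov\<close>). This factor is the Laplace transform of \<open>\<xi> t\<close> at \<open>k - 1\<close>.

Everything about one fixed time follows by inclusion-exclusion. That \<open>V\<close> is exactly a block
is an alternating sum of the events \<open>together W\<close> with \<open>W \<supseteq> V\<close>, and the same alternating sum of
\<open>exp (- (card W - 1) * x)\<close> is \<open>G_fun n (card V) x\<close>. So \<open>V\<close> is a block at time \<open>t\<close> with probability
\<open>E (G_fun n (card V) (\<xi> t))\<close> (\<open>prob_block_G\<close>). Taking \<open>V = {u}\<close> gives the tail of the height, and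
summing over all \<open>V\<close> with at least two labels gives the expected number of non-singleton blocks.
Integration over \<open>t\<close> turns these identities into the formulas for the expected height and the expected
total length.

The Markov form of the decay, used with a present partition that is not good for \<open>V\<close>, shows that
almost every path only ever refines. Because the decay factors tend to \<open>0\<close> when \<open>V\<close> has two labels, it
also reaches the partition into singletons. On such a path
the block of a leaf has each size \<open>j \<ge> 2\<close> during a single, possibly empty, interval \<open>[a, c)\<close>. Its jump times
are the right end points of these intervals, so that the discrete height
counts the sizes \<open>j \<ge> 2\<close> that are visited (\<open>discrete_height_eq\<close>), and its expectation is the sum of
the clade probabilities.

For the clade probability, consider the amount of time \<open>t\<close> for which the size is \<open>j\<close> at
\<open>t\<close> but no longer at \<open>t + h\<close>. On a refining path it is \<open>min (c - a) h\<close> if \<open>j\<close> is visited and \<open>0\<close>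
otherwise, so divided by \<open>h\<close> it tends to the indicator of a visit as \<open>h\<close> tends to \<open>0\<close>
(\<open>exit_window\<close>). Its expectation is \<open>1 - exp (- h * phi \<beta> (j - 1))\<close> times the expected time spent at
size \<open>j\<close>, and the limit gives the factor \<open>phi \<beta> (j - 1)\<close> (\<open>clade_prob_eq_potential\<close>).

Finally, \<open>T\<^sub>x > t\<close> holds exactly when \<open>\<xi> t < x\<close>, because \<open>\<xi>\<close> is increasing and right-continuous. Since
\<open>F_fun n\<close> is the tail function of the maximum of \<open>n - 1\<close> standard exponentials, the passage time over
such an independent maximum has the tail found for the height.\<close>

section \<open>Beta integrals and the values of the Laplace exponent at the integers\<close>

text \<open>A geometric sum splits off the factor \<open>1 - s\<close>, after which every summand is a beta density up to
normalisation, integrable for \<open>\<beta> > -2\<close> because both exponents exceed \<open>-1\<close>.\<close>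

lemma phi_integrand_eq:
  assumes "0 < s" "s < 1"
  shows "(1 - s powr real m) * (s powr (\<beta> + 1) * (1 - s) powr \<beta>) =
    (\<Sum>k=1..m. s ^ k * (1 - s) * (s powr \<beta> * (1 - s) powr \<beta>))"
proof -
  have "s * (1 - s ^ m) = (\<Sum>k=1..m. s ^ k * (1 - s))"
  proof (induction m)
    case (Suc m)
    then show ?case by (simp add: algebra_simps)
  qed simp
  moreover have "s powr (\<beta> + 1) = s * s powr \<beta>" using assms by (simp add: powr_add)
  moreover have "s powr real m = s ^ m" using assms by (simp add: powr_realpow)
  ultimately have "(1 - s powr real m) * (s powr (\<beta> + 1) * (1 - s) powr \<beta>) =
    (\<Sum>k=1..m. s ^ k * (1 - s)) * (s powr \<beta> * (1 - s) powr \<beta>)"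
    by (simp add: mult_ac)
  then show ?thesis by (simp only: sum_distrib_right)
qed

lemma has_bochner_integral_beta_weight:
  fixes i k :: nat
  assumes "\<beta> > -2" "i \<ge> 1" "k \<ge> 1"
  shows "has_bochner_integral lborel
    (\<lambda>s. indicator {0<..<1} s * (s ^ i * (1 - s) ^ k * (s powr \<beta> * (1 - s) powr \<beta>)))
    (Beta (real i + \<beta> + 1) (real k + \<beta> + 1))"
proof -
  let ?f = "\<lambda>s::real. s ^ i * (1 - s) ^ k * (s powr \<beta> * (1 - s) powr \<beta>)"
  have "((\<lambda>t. t powr (real i + \<beta> + 1 - 1) * (1 - t) powr (real k + \<beta> + 1 - 1)) has_integral
    Beta (real i + \<beta> + 1) (real k + \<beta> + 1)) {0..1}"
    using assms by (intro has_integral_Beta_real) auto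
  then have "((\<lambda>t. t powr (real i + \<beta>) * (1 - t) powr (real k + \<beta>)) has_integral
    Beta (real i + \<beta> + 1) (real k + \<beta> + 1)) {0<..<1}"
    by (simp add: has_integral_Icc_iff_Ioo)
  then have *: "(?f has_integral Beta (real i + \<beta> + 1) (real k + \<beta> + 1)) {0<..<1}"
    by (rule has_integral_eq[rotated]) (auto simp: powr_add powr_realpow mult_ac)
  have "set_integrable lebesgue {0<..<1} ?f"
    by (rule nonnegative_absolutely_integrable_1) (use * in \<open>auto simp: has_integral_iff\<close>)
  then have "set_integrable lborel {0<..<1} ?f"
    unfolding set_integrable_def by (subst (asm) integrable_completion) auto
  then have "has_bochner_integral lborel (\<lambda>s. indicator {0<..<1} s *\<^sub>R ?f s) (integral {0<..<1} ?f)"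
    unfolding has_bochner_integral_iff set_integrable_def[symmetric]
    using set_borel_integral_eq_integral(2)[of "{0<..<1}" ?f] by (auto simp: set_lebesgue_integral_def)
  then show ?thesis using * by (auto simp: has_integral_iff)
qed

lemma Beta_pos: "0 < a \<Longrightarrow> 0 < b \<Longrightarrow> 0 < Beta a (b::real)"
  by (simp add: Beta_def Gamma_real_pos)

lemma has_bochner_integral_phi:
  assumes "\<beta> > -2"
  shows "has_bochner_integral lborel
    (\<lambda>s. indicator {0<..<1} s * ((1 - s powr real m) * (s powr (\<beta> + 1) * (1 - s) powr \<beta>)))
    (\<Sum>k=1..m. Beta (real k + \<beta> + 1) (\<beta> + 2))"
proof -
  have "has_bochner_integral lborel
    (\<lambda>s. \<Sum>k=1..m. indicator {0<..<1} s * (s ^ k * (1 - s) ^ 1 * (s powr \<beta> * (1 - s) powr \<beta>)))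
    (\<Sum>k=1..m. Beta (real k + \<beta> + 1) (real 1 + \<beta> + 1))"
    using assms by (intro has_bochner_integral_sum has_bochner_integral_beta_weight) auto
  moreover have "(\<lambda>s. \<Sum>k=1..m. indicator {0<..<1} s * (s ^ k * (1 - s) ^ 1 * (s powr \<beta> * (1 - s) powr \<beta>))) =
    (\<lambda>s. indicator {0<..<1} s * ((1 - s powr real m) * (s powr (\<beta> + 1) * (1 - s) powr \<beta>)))"
    by (rule ext) (auto simp: indicator_def phi_integrand_eq[simplified] )
  ultimately show ?thesis by (simp add: add_ac)
qed

lemma phi_nat:
  assumes "\<beta> > -2"
  shows "phi \<beta> (real m) = (\<Sum>k=1..m. Beta (real k + \<beta> + 1) (\<beta> + 2))"
  using has_bochner_integral_phi[OF assms, of m]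
  by (simp add: has_bochner_integral_iff phi_def set_lebesgue_integral_def)

lemma phi_complex_of_nat: "phi \<beta> (complex_of_real (real m)) = complex_of_real (phi \<beta> (real m))"
proof -
  have "(1 - complex_of_real s powr complex_of_real (real m)) * complex_of_real (s powr (\<beta> + 1) * (1 - s) powr \<beta>) =
    complex_of_real ((1 - s powr real m) * (s powr (\<beta> + 1) * (1 - s) powr \<beta>))" if "0 < s" for s
    using that by (simp add: powr_of_real powr_realpow)
  then have "(\<lambda>s. indicator {0<..<1} s *\<^sub>R ((1 - complex_of_real s powr complex_of_real (real m)) * complex_of_real (s powr (\<beta> + 1) * (1 - s) powr \<beta>))) =
    (\<lambda>s. complex_of_real (indicator {0<..<1} s *\<^sub>R ((1 - s powr real m) * (s powr (\<beta> + 1) * (1 - s) powr \<beta>))))"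
    by (intro ext) (auto simp: indicator_def)
  then show ?thesis
    unfolding phi_def set_lebesgue_integral_def by (simp del: of_real_mult)
qed

lemma phi_zero: "\<beta> > -2 \<Longrightarrow> phi \<beta> (0::real) = 0"
  using phi_nat[of \<beta> 0] by simp

lemma phi_pos: "\<beta> > -2 \<Longrightarrow> m \<ge> 1 \<Longrightarrow> phi \<beta> (real m) > 0"
  unfolding phi_nat by (intro sum_pos Beta_pos) auto

text \<open>The binomial theorem in its subset form: each element of \<open>A\<close> independently goes to \<open>S\<close> with weight
\<open>x\<close> or to the complement with weight \<open>y\<close>, the elements of \<open>V\<close> being forced into \<open>S\<close>.\<close>

lemma sum_subsets_split:
  fixes x y :: "'b::comm_semiring_1"
  assumes "finite A" "V \<subseteq> A"
  shows "(\<Sum>S\<in>{S. V \<subseteq> S \<and> S \<subseteq> A}. x ^ card S * y ^ card (A - S)) = x ^ card V * (x + y) ^ card (A - V)"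
proof -
  have fin: "finite V" "finite (A - V)" using assms finite_subset by auto
  have "(\<Sum>S\<in>{S. V \<subseteq> S \<and> S \<subseteq> A}. x ^ card S * y ^ card (A - S)) =
    (\<Sum>Z\<in>Pow (A - V). x ^ card V * (x ^ card Z * y ^ card (A - V - Z)))"
  proof (rule sum.reindex_bij_witness[of _ "\<lambda>Z. V \<union> Z" "\<lambda>S. S - V"])
    fix S assume S: "S \<in> {S. V \<subseteq> S \<and> S \<subseteq> A}"
    then have "finite S" using assms finite_subset by auto
    then have "card S = card V + card (S - V)" using S fin
      by (metis (mono_tags, lifting) card_Diff_subset card_mono le_add_diff_inverse mem_Collect_eq)
    moreover have "A - V - (S - V) = A - S" using S by auto
    ultimately show "x ^ card V * (x ^ card (S - V) * y ^ card (A - V - (S - V))) = x ^ card S * y ^ card (A - S)"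
      by (simp add: power_add mult_ac)
  qed (use assms in auto)
  also have "\<dots> = x ^ card V * (x + y) ^ card (A - V)"
    using prod_add[of "A - V" "\<lambda>_. x" "\<lambda>_. y"] fin by (simp flip: sum_distrib_left)
  finally show ?thesis .
qed

definition separates :: "'a set \<Rightarrow> 'a set \<Rightarrow> bool" where
  "separates S V \<longleftrightarrow> S \<inter> V \<noteq> {} \<and> V - S \<noteq> {}"

text \<open>If every label of \<open>A\<close> is put into \<open>S\<close> independently with probability \<open>s\<close>, then \<open>V\<close> stays in one
part with probability \<open>s ^ card V + (1 - s) ^ card V\<close>, whatever the other labels do.\<close>

lemma sum_separating_subsets:
  fixes s :: real
  assumes "finite A" "V \<subseteq> A" "V \<noteq> {}"
  shows "(\<Sum>S\<in>{S. S \<subseteq> A \<and> separates S V}. s ^ card S * (1 - s) ^ card (A - S)) =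
     1 - s ^ card V - (1 - s) ^ card V"
proof -
  let ?g = "\<lambda>S. s ^ card S * (1 - s) ^ card (A - S)"
  have 1: "sum ?g (Pow A) = 1"
    using sum_subsets_split[OF assms(1), of "{}" s "1 - s"] by (simp add: Pow_def)
  have 2: "sum ?g {S. V \<subseteq> S \<and> S \<subseteq> A} = s ^ card V"
    using sum_subsets_split[OF assms(1,2), of s "1 - s"] by simp
  have "sum ?g {S. S \<subseteq> A \<and> S \<inter> V = {}} = (\<Sum>S\<in>{S. V \<subseteq> S \<and> S \<subseteq> A}. (1 - s) ^ card S * s ^ card (A - S))"
    by (rule sum.reindex_bij_witness[of _ "\<lambda>S. A - S" "\<lambda>S. A - S"]) (use assms in \<open>auto simp: double_diff\<close>)
  also have "\<dots> = (1 - s) ^ card V"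
    using sum_subsets_split[OF assms(1,2), of "1 - s" s] by simp
  finally have 3: "sum ?g {S. S \<subseteq> A \<and> S \<inter> V = {}} = (1 - s) ^ card V" .
  have "Pow A = {S. S \<subseteq> A \<and> separates S V} \<union> ({S. V \<subseteq> S \<and> S \<subseteq> A} \<union> {S. S \<subseteq> A \<and> S \<inter> V = {}})"
    by (auto simp: separates_def)
  moreover have "finite {S. S \<subseteq> A \<and> separates S V}" "finite {S. V \<subseteq> S \<and> S \<subseteq> A}" "finite {S. S \<subseteq> A \<and> S \<inter> V = {}}"
    using assms(1) by (auto intro: finite_subset[of _ "Pow A"])
  moreover have "{S. S \<subseteq> A \<and> separates S V} \<inter> ({S. V \<subseteq> S \<and> S \<subseteq> A} \<union> {S. S \<subseteq> A \<and> S \<inter> V = {}}) = {}"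
    "{S. V \<subseteq> S \<and> S \<subseteq> A} \<inter> {S. S \<subseteq> A \<and> S \<inter> V = {}} = {}"
    using assms(3) by (auto simp: separates_def)
  ultimately have "sum ?g (Pow A) = sum ?g {S. S \<subseteq> A \<and> separates S V} + (sum ?g {S. V \<subseteq> S \<and> S \<subseteq> A} + sum ?g {S. S \<subseteq> A \<and> S \<inter> V = {}})"
    by (simp add: sum.union_disjoint)
  then show ?thesis using 1 2 3 by simp
qed

text \<open>Sampling consistency: the rate at which a block separates \<open>V\<close> does not depend on the block. Both sides
are half the integral of \<open>1 - s ^ card V - (1 - s) ^ card V\<close> against \<open>s\<^sup>\<beta> (1 - s)\<^sup>\<beta>\<close>; for \<open>phi\<close> this
is its defining integral symmetrised under \<open>s \<mapsto> 1 - s\<close>, which on the level of beta functions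
is the symmetry of \<open>Beta\<close>.\<close>

lemma separating_rate:
  assumes "\<beta> > -2" "finite A" "V \<subseteq> A" "V \<noteq> {}"
  shows "(\<Sum>S\<in>{S. S \<subseteq> A \<and> separates S V}. Beta (real (card S) + \<beta> + 1) (real (card (A - S)) + \<beta> + 1) / 2)
    = phi \<beta> (real (card V) - 1)"
proof -
  let ?w = "\<lambda>s::real. s powr \<beta> * (1 - s) powr \<beta>"
  let ?J = "{S. S \<subseteq> A \<and> separates S V}"
  define m where "m = card V - 1"
  have cV: "card V = Suc m" using assms finite_subset[of V A] by (simp add: m_def card_gt_0_iff)
  have "has_bochner_integral lborel
    (\<lambda>s. \<Sum>S\<in>?J. indicator {0<..<1} s * (s ^ card S * (1 - s) ^ card (A - S) * ?w s))
    (\<Sum>S\<in>?J. Beta (real (card S) + \<beta> + 1) (real (card (A - S)) + \<beta> + 1))"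
  proof (intro has_bochner_integral_sum has_bochner_integral_beta_weight)
    fix S assume S: "S \<in> ?J"
    then have "finite S" "S \<noteq> {}" "A - S \<noteq> {}" using assms finite_subset by (auto simp: separates_def)
    then show "1 \<le> card S" "1 \<le> card (A - S)" using assms by (auto simp: Suc_le_eq card_gt_0_iff)
  qed (rule assms(1))
  moreover have "(\<lambda>s. \<Sum>S\<in>?J. indicator {0<..<1} s * (s ^ card S * (1 - s) ^ card (A - S) * ?w s)) =
     (\<lambda>s. indicator {0<..<1} s * ((1 - s ^ card V - (1 - s) ^ card V) * ?w s))"
    unfolding sum_separating_subsets[OF assms(2-4), symmetric]
    by (simp add: sum_distrib_left sum_distrib_right mult_ac)
  ultimately have L: "has_bochner_integral lborel
     (\<lambda>s. indicator {0<..<1} s * ((1 - s ^ card V - (1 - s) ^ card V) * ?w s))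
    (\<Sum>S\<in>?J. Beta (real (card S) + \<beta> + 1) (real (card (A - S)) + \<beta> + 1))" by simp
  have "has_bochner_integral lborel
    (\<lambda>s. (\<Sum>k=1..m. indicator {0<..<1} s * (s ^ k * (1 - s) ^ 1 * ?w s)) +
      (\<Sum>k=1..m. indicator {0<..<1} s * (s ^ 1 * (1 - s) ^ k * ?w s)))
    ((\<Sum>k=1..m. Beta (real k + \<beta> + 1) (real 1 + \<beta> + 1)) + (\<Sum>k=1..m. Beta (real 1 + \<beta> + 1) (real k + \<beta> + 1)))"
    using assms by (intro has_bochner_integral_add has_bochner_integral_sum has_bochner_integral_beta_weight) auto
  moreover have "(\<lambda>s::real. (\<Sum>k=1..m. indicator {0<..<1} s * (s ^ k * (1 - s) ^ 1 * ?w s)) +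
      (\<Sum>k=1..m. indicator {0<..<1} s * (s ^ 1 * (1 - s) ^ k * ?w s))) =
    (\<lambda>s. indicator {0<..<1} s * ((1 - s ^ card V - (1 - s) ^ card V) * ?w s))"
  proof
    fix s :: real
    have *: "(\<Sum>k=1..m. t ^ k * (1 - t)) = t - t ^ Suc m" for t :: real
      by (induction m) (simp_all add: algebra_simps)
    \<comment> \<open>The two sums telescope to \<open>s - s ^ Suc m\<close> and to its mirror image under \<open>s \<mapsto> 1 - s\<close>.\<close>
    have "1 - s ^ Suc m - (1 - s) ^ Suc m = (\<Sum>k=1..m. s ^ k * (1 - s)) + (\<Sum>k=1..m. (1 - s) ^ k * (1 - (1 - s)))"
      unfolding * by simp
    then show "(\<Sum>k=1..m. indicator {0<..<1} s * (s ^ k * (1 - s) ^ 1 * ?w s)) +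
      (\<Sum>k=1..m. indicator {0<..<1} s * (s ^ 1 * (1 - s) ^ k * ?w s)) =
    indicator {0<..<1} s * ((1 - s ^ card V - (1 - s) ^ card V) * ?w s)"
      unfolding cV by (simp add: sum_distrib_left sum_distrib_right distrib_left distrib_right mult_ac)
  qed
  moreover have "(\<Sum>k=1..m. Beta (real k + \<beta> + 1) (real 1 + \<beta> + 1)) + (\<Sum>k=1..m. Beta (real 1 + \<beta> + 1) (real k + \<beta> + 1)) =
    2 * phi \<beta> (real m)"
    unfolding phi_nat[OF assms(1)] by (simp add: Beta_commute[of "\<beta> + 2"] add_ac)
  ultimately have R: "has_bochner_integral lborel
     (\<lambda>s. indicator {0<..<1} s * ((1 - s ^ card V - (1 - s) ^ card V) * ?w s)) (2 * phi \<beta> (real m))" by simp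
  have "(\<Sum>S\<in>?J. Beta (real (card S) + \<beta> + 1) (real (card (A - S)) + \<beta> + 1)) = 2 * phi \<beta> (real m)"
    using has_bochner_integral_eq[OF L R] .
  then show ?thesis by (simp add: cV flip: sum_divide_distrib)
qed

section \<open>Eigenvectors of a generator\<close>

lemma matrix_pow_eigenvector:
  assumes "finite S" "\<And>x. x \<in> S \<Longrightarrow> (\<Sum>y\<in>S. Q x y * f y) = l * f x" "x \<in> S"
  shows "(\<Sum>y\<in>S. matrix_pow S Q k x y * f y) = l ^ k * f x"
  using assms(3)
proof (induction k arbitrary: x)
  case 0
  have "(\<Sum>y\<in>S. (if x = y then 1 else 0) * f y) = (\<Sum>y\<in>S. if x = y then f y else 0)"
    by (intro sum.cong) auto
  then show ?case using 0 assms(1) by simp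
next
  case (Suc k)
  have "(\<Sum>y\<in>S. matrix_pow S Q (Suc k) x y * f y) = (\<Sum>y\<in>S. \<Sum>z\<in>S. Q x z * (matrix_pow S Q k z y * f y))"
    by (simp add: sum_distrib_right mult.assoc)
  also have "\<dots> = (\<Sum>z\<in>S. Q x z * (\<Sum>y\<in>S. matrix_pow S Q k z y * f y))"
    by (subst sum.swap) (simp add: sum_distrib_left)
  also have "\<dots> = (\<Sum>z\<in>S. l ^ k * (Q x z * f z))"
    using Suc.IH by (intro sum.cong) (auto simp: mult_ac)
  also have "\<dots> = l ^ Suc k * f x"
    using assms(2)[OF Suc.prems] by (simp flip: sum_distrib_left)
  finally show ?case .
qed

lemma abs_matrix_pow_le:
  assumes "finite S" "x \<in> S"
  shows "\<bar>matrix_pow S Q k x y\<bar> \<le> (\<Sum>u\<in>S. \<Sum>z\<in>S. \<bar>Q u z\<bar>) ^ k"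
  using assms(2)
proof (induction k arbitrary: x)
  case (Suc k)
  let ?C = "\<Sum>u\<in>S. \<Sum>z\<in>S. \<bar>Q u z\<bar>"
  have C: "0 \<le> ?C" by (intro sum_nonneg) auto
  have "\<bar>matrix_pow S Q (Suc k) x y\<bar> \<le> (\<Sum>z\<in>S. \<bar>Q x z\<bar> * \<bar>matrix_pow S Q k z y\<bar>)"
    by (simp flip: abs_mult)
  also have "\<dots> \<le> (\<Sum>z\<in>S. \<bar>Q x z\<bar> * ?C ^ k)"
    using Suc.IH by (intro sum_mono mult_left_mono) auto
  also have "\<dots> = (\<Sum>z\<in>S. \<bar>Q x z\<bar>) * ?C ^ k" by (simp add: sum_distrib_right)
  also have "\<dots> \<le> ?C * ?C ^ k"
    using C Suc.prems assms(1) by (intro mult_right_mono member_le_sum[of x S "\<lambda>u. \<Sum>z\<in>S. \<bar>Q u z\<bar>"] sum_nonneg) auto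
  finally show ?case by simp
qed auto

lemma transition_prob_eigenvector:
  assumes "finite S" "\<And>x. x \<in> S \<Longrightarrow> (\<Sum>y\<in>S. Q x y * f y) = l * f x" "x \<in> S"
  shows "(\<Sum>y\<in>S. transition_prob S Q t x y * f y) = exp (t * l) * f x"
proof -
  let ?C = "\<Sum>u\<in>S. \<Sum>z\<in>S. \<bar>Q u z\<bar>"
  have C: "0 \<le> ?C" by (intro sum_nonneg) auto
  have s: "summable (\<lambda>k. t ^ k / fact k * matrix_pow S Q k x y)" for y
  proof (rule summable_comparison_test)
    show "\<exists>N. \<forall>k\<ge>N. norm (t ^ k / fact k * matrix_pow S Q k x y) \<le> inverse (fact k) *\<^sub>R (\<bar>t\<bar> * ?C) ^ k"
      using abs_matrix_pow_le[OF assms(1,3), of Q _ y] C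
      by (auto simp: abs_mult power_mult_distrib power_abs divide_inverse mult_ac intro!: mult_left_mono)
    show "summable (\<lambda>k. inverse (fact k) *\<^sub>R (\<bar>t\<bar> * ?C) ^ k)"
      by (rule summable_exp_generic)
  qed
  have "(\<Sum>y\<in>S. transition_prob S Q t x y * f y) = (\<Sum>y\<in>S. \<Sum>k. t ^ k / fact k * matrix_pow S Q k x y * f y)"
    unfolding transition_prob_def by (intro sum.cong refl suminf_mult2 s)
  also have "\<dots> = (\<Sum>k. \<Sum>y\<in>S. t ^ k / fact k * matrix_pow S Q k x y * f y)"
    by (intro suminf_sum[symmetric] summable_mult2 s)
  also have "\<dots> = (\<Sum>k. (t * l) ^ k /\<^sub>R fact k * f x)"
    by (simp only: mult.assoc sum_distrib_left[symmetric] matrix_pow_eigenvector[OF assms])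
      (simp add: power_mult_distrib divide_inverse mult_ac)
  also have "\<dots> = exp (t * l) * f x"
    unfolding exp_def by (rule suminf_mult2[symmetric]) (rule summable_exp_generic)
  finally show ?thesis .
qed

section \<open>Sampling consistency of the splitting rates\<close>

definition together :: "'a set \<Rightarrow> 'a set set \<Rightarrow> bool" where
  "together V \<pi> \<longleftrightarrow> (\<exists>A\<in>\<pi>. V \<subseteq> A)"

lemma finite_label_partitions: "finite (label_partitions n)"
  by (rule finite_subset[of _ "Pow (Pow {1..n})"]) (auto simp: label_partitions_def partition_on_def)

lemma split_block_label_partitions:
  assumes "\<pi> \<in> label_partitions n" "A \<in> \<pi>" "S \<subset> A" "S \<noteq> {}"
  shows "split_block \<pi> A S \<in> label_partitions n" "split_block \<pi> A S \<noteq> \<pi>"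
proof -
  have p: "partition_on {1..n} \<pi>" using assms by (simp add: label_partitions_def)
  have d: "disjoint \<pi>" "\<Union>\<pi> = {1..n}" "{} \<notin> \<pi>" using p by (auto simp: partition_on_def)
  have "S \<notin> \<pi>" using d(1) assms(2-4) by (auto dest: disjointD)
  then show "split_block \<pi> A S \<noteq> \<pi>" by (auto simp: split_block_def)
  have *: "B \<inter> A = {}" if "B \<in> \<pi> - {A}" for B using that d(1) assms(2) by (auto dest: disjointD)
  have "\<Union>(split_block \<pi> A S) = {1..n}" using d(2) assms(2-3) by (auto simp: split_block_def)
  moreover have "disjoint (split_block \<pi> A S)"
    unfolding disjoint_def split_block_def
  proof (intro ballI impI)
    fix B C assume "B \<in> \<pi> - {A} \<union> {S, A - S}" "C \<in> \<pi> - {A} \<union> {S, A - S}" "B \<noteq> C"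
    then consider "B \<in> \<pi> - {A}" "C \<in> \<pi> - {A}" | "B \<in> \<pi> - {A}" "C \<subseteq> A" | "B \<subseteq> A" "C \<in> \<pi> - {A}"
      | "B = S" "C = A - S" | "C = S" "B = A - S"
      using assms(3) by blast
    then show "B \<inter> C = {}"
      proof cases
      case 1
      then show ?thesis using disjointD[OF d(1), of B C] \<open>B \<noteq> C\<close> by simp
    qed (use *[of B] *[of C] in blast)+
  qed
  moreover have "{} \<notin> split_block \<pi> A S" using d(3) assms by (auto simp: split_block_def)
  ultimately show "split_block \<pi> A S \<in> label_partitions n"
    by (simp add: label_partitions_def partition_on_def)
qed

lemma together_split_block:
  assumes "\<pi> \<in> label_partitions n" "A \<in> \<pi>" "S \<subset> A" "V \<noteq> {}"
  shows "together V (split_block \<pi> A S) \<longleftrightarrow> together V \<pi> \<and> \<not> (V \<subseteq> A \<and> separates S V)"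
proof -
  have d: "disjoint \<pi>" using assms by (auto simp: label_partitions_def partition_on_def)
  have *: "B = A" if "B \<in> \<pi>" "V \<subseteq> A" "V \<subseteq> B" for B
    using disjointD[OF d that(1) assms(2)] that(2,3) assms(4) by auto
  have "V \<subseteq> A \<Longrightarrow> V \<subseteq> S \<or> V \<subseteq> A - S \<longleftrightarrow> \<not> separates S V"
    by (auto simp: separates_def)
  moreover have "together V (split_block \<pi> A S) \<longleftrightarrow> (\<exists>B\<in>\<pi>-{A}. V \<subseteq> B) \<or> V \<subseteq> S \<or> V \<subseteq> A - S"
    by (auto simp: together_def split_block_def)
  moreover have "(\<exists>B\<in>\<pi>-{A}. V \<subseteq> B) \<longleftrightarrow> together V \<pi> \<and> \<not> V \<subseteq> A"
    using * assms(2) by (auto simp: together_def)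
  moreover have "V \<subseteq> S \<or> V \<subseteq> A - S \<Longrightarrow> V \<subseteq> A" using assms(3) by auto
  moreover have "V \<subseteq> A \<Longrightarrow> together V \<pi>" using assms(2) by (auto simp: together_def)
  ultimately show ?thesis by blast
qed

text \<open>The rate at which a block \<open>A\<close> splits into the ordered pair \<open>(S, A - S)\<close>: the factor \<open>phi\<close> in the
holding rate cancels against the normalisation of \<open>split_size_prob\<close>.\<close>

definition split_rate :: "real \<Rightarrow> 'a set \<Rightarrow> 'a set \<Rightarrow> real" where
  "split_rate \<beta> A S = Beta (real (card S) + \<beta> + 1) (real (card (A - S)) + \<beta> + 1) / 2"

lemma split_rate_eq:
  assumes "\<beta> > -2" "finite A" "S \<subseteq> A" "2 \<le> card A"
  shows "phi \<beta> (real (card A) - 1) * (split_size_prob \<beta> (card A) (card S) / real (card A choose card S)) = split_rate \<beta> A S"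
proof -
  have "phi \<beta> (real (card A - 1)) > 0" using assms by (intro phi_pos) auto
  then have "phi \<beta> (real (card A) - 1) \<noteq> 0" using assms by (simp add: of_nat_diff)
  moreover have "card S \<le> card A" "finite S" using assms by (auto simp: card_mono finite_subset)
  moreover have "real (card (A - S)) = real (card A) - real (card S)"
    using assms \<open>card S \<le> card A\<close> \<open>finite S\<close> by (simp add: card_Diff_subset of_nat_diff)
  ultimately show ?thesis
    unfolding split_rate_def split_size_prob_def by (simp add: binomial_eq_0_iff)
qed

text \<open>A jump can only destroy \<open>together V\<close>, and does so exactly if it splits the block around \<open>V\<close> in a
way that separates \<open>V\<close>. The total rate of those jumps is \<open>phi \<beta> (card V - 1)\<close> by \<open>separating_rate\<close>.
The same lemma with \<open>V = A\<close> says that the off-diagonal rates of the splits of \<open>A\<close> add up to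
\<open>phi \<beta> (card A - 1)\<close>, so that the remaining jumps cancel against the diagonal.\<close>

lemma splitting_rate_eigenvector:
  assumes \<beta>: "\<beta> > -2" and V: "V \<noteq> {}" and \<pi>: "\<pi> \<in> label_partitions n"
  shows "(\<Sum>\<rho>\<in>label_partitions n. splitting_rate \<beta> \<pi> \<rho> * of_bool (together V \<rho>)) =
    - phi \<beta> (real (card V) - 1) * of_bool (together V \<pi>)"
proof -
  let ?S = "label_partitions n"
  let ?f = "\<lambda>\<rho>. of_bool (together V \<rho>) :: real"
  let ?\<pi>2 = "{A\<in>\<pi>. 2 \<le> card A}"
  let ?J = "\<lambda>A. {S. S \<noteq> {} \<and> S \<subset> A}"
  let ?P = "Sigma ?\<pi>2 ?J"
  have fin\<pi>: "finite \<pi>" and finA: "\<And>A. A \<in> \<pi> \<Longrightarrow> finite A" and dis: "disjoint \<pi>" and ne: "{} \<notin> \<pi>"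
    using \<pi> finite_elements[of "{1..n}" \<pi>] finite_subset[of _ "{1..n}"] by (auto simp: label_partitions_def partition_on_def)
  have finJ: "finite (?J A)" if "A \<in> \<pi>" for A
    by (rule finite_subset[of _ "Pow A"]) (use finA[OF that] in auto)
  have finP: "finite ?P" using fin\<pi> finJ by (intro finite_SigmaI) auto
  have total: "(\<Sum>S\<in>?J A. split_rate \<beta> A S) = phi \<beta> (real (card A) - 1)" if "A \<in> \<pi>" for A
  proof -
    have "{S. S \<subseteq> A \<and> separates S A} = ?J A" by (auto simp: separates_def)
    then show ?thesis using separating_rate[OF \<beta> finA[OF that], of A] ne that by (auto simp: split_rate_def)
  qed
  define g where "g = (\<lambda>(A, S). split_block \<pi> A S)"
  define h where "h = (\<lambda>(A, S). split_rate \<beta> A S * ?f (split_block \<pi> A S))"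
  have "(\<Sum>\<rho>\<in>?S - {\<pi>}. splitting_rate \<beta> \<pi> \<rho> * ?f \<rho>) = (\<Sum>\<rho>\<in>?S - {\<pi>}. sum h {p\<in>?P. g p = \<rho>})"
  proof (intro sum.cong refl)
    fix \<rho> assume "\<rho> \<in> ?S - {\<pi>}"
    then have "splitting_rate \<beta> \<pi> \<rho> * ?f \<rho> =
      (\<Sum>(A, S)\<in>{(A, S). A \<in> \<pi> \<and> 2 \<le> card A \<and> S \<noteq> {} \<and> S \<subset> A \<and> split_block \<pi> A S = \<rho>}.
              phi \<beta> (real (card A) - 1) *
              (split_size_prob \<beta> (card A) (card S) / real (card A choose card S))) * ?f \<rho>"
      by (auto simp: splitting_rate_def)
    also have "\<dots> = sum h {p\<in>?P. g p = \<rho>}"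
      unfolding sum_distrib_right
      proof (intro sum.cong)
      fix p assume "p \<in> {p\<in>?P. g p = \<rho>}"
      then obtain A S where p: "p = (A, S)" "A \<in> \<pi>" "2 \<le> card A" "S \<subseteq> A" "split_block \<pi> A S = \<rho>"
        by (auto simp: g_def)
      show "(case p of (A, S) \<Rightarrow> phi \<beta> (real (card A) - 1) *
              (split_size_prob \<beta> (card A) (card S) / real (card A choose card S))) * ?f \<rho> = h p"
        unfolding p(1) h_def prod.case split_rate_eq[OF \<beta> finA[OF p(2)] p(4,3)] p(5) ..
    qed (auto simp: g_def)
    finally show "splitting_rate \<beta> \<pi> \<rho> * ?f \<rho> = \<dots>" .
  qed
  also have "\<dots> = sum h ?P"
  proof (rule sum.group)
    show "g ` ?P \<subseteq> ?S - {\<pi>}"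
    proof (rule image_subsetI)
      fix p assume "p \<in> ?P"
      then obtain A S where p: "p = (A, S)" "A \<in> \<pi>" "S \<subset> A" "S \<noteq> {}" by auto
      show "g p \<in> ?S - {\<pi>}"
        unfolding p(1) g_def using split_block_label_partitions[OF \<pi> p(2-4)] by simp
    qed
  qed (use finP finite_label_partitions in auto)
  also have "\<dots> = (\<Sum>A\<in>?\<pi>2. \<Sum>S\<in>?J A. split_rate \<beta> A S * ?f (split_block \<pi> A S))"
    unfolding h_def by (rule sum.Sigma[symmetric]) (use fin\<pi> finJ in auto)
  also have "\<dots> = (\<Sum>A\<in>?\<pi>2. (phi \<beta> (real (card A) - 1) - (if V \<subseteq> A then phi \<beta> (real (card V) - 1) else 0)) * ?f \<pi>)"
  proof (intro sum.cong refl)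
    fix A assume A: "A \<in> ?\<pi>2"
    have "(\<Sum>S\<in>?J A. split_rate \<beta> A S * ?f (split_block \<pi> A S)) =
      (\<Sum>S\<in>?J A. (split_rate \<beta> A S - (if V \<subseteq> A \<and> separates S V then split_rate \<beta> A S else 0)) * ?f \<pi>)"
      using A by (intro sum.cong) (auto simp: together_split_block[OF \<pi> _ _ V])
    also have "\<dots> = (phi \<beta> (real (card A) - 1) - (\<Sum>S\<in>?J A. if V \<subseteq> A \<and> separates S V then split_rate \<beta> A S else 0)) * ?f \<pi>"
      using total A by (simp flip: sum_distrib_right add: sum_subtractf)
    also have "(\<Sum>S\<in>?J A. if V \<subseteq> A \<and> separates S V then split_rate \<beta> A S else 0) = (if V \<subseteq> A then phi \<beta> (real (card V) - 1) else 0)"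
    proof (cases "V \<subseteq> A")
      case True
      have "(\<Sum>S\<in>?J A. if separates S V then split_rate \<beta> A S else 0) = (\<Sum>S\<in>{S\<in>?J A. separates S V}. split_rate \<beta> A S)"
        using finJ A by (subst sum.inter_filter) auto
      also have "{S\<in>?J A. separates S V} = {S. S \<subseteq> A \<and> separates S V}"
        using True by (auto simp: separates_def)
      finally show ?thesis
        using separating_rate[OF \<beta> finA True V] A True by (auto simp: split_rate_def)
    qed auto
    finally show "(\<Sum>S\<in>?J A. split_rate \<beta> A S * ?f (split_block \<pi> A S)) =
      (phi \<beta> (real (card A) - 1) - (if V \<subseteq> A then phi \<beta> (real (card V) - 1) else 0)) * ?f \<pi>" .
  qed
  also have "\<dots> = (\<Sum>A\<in>?\<pi>2. phi \<beta> (real (card A) - 1)) * ?f \<pi> - (\<Sum>A\<in>?\<pi>2. if V \<subseteq> A then phi \<beta> (real (card V) - 1) else 0) * ?f \<pi>"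
    by (simp flip: sum_distrib_right add: sum_subtractf left_diff_distrib)
  also have "(\<Sum>A\<in>?\<pi>2. if V \<subseteq> A then phi \<beta> (real (card V) - 1) else 0) * ?f \<pi> = phi \<beta> (real (card V) - 1) * ?f \<pi>"
  proof (cases "together V \<pi>")
    case True
    then obtain B where B: "B \<in> \<pi>" "V \<subseteq> B" by (auto simp: together_def)
    have eq: "V \<subseteq> A \<longleftrightarrow> A = B" if "A \<in> \<pi>" for A
      using disjointD[OF dis that B(1)] B(2) V by auto
    have "(\<Sum>A\<in>?\<pi>2. if V \<subseteq> A then phi \<beta> (real (card V) - 1) else 0) = (\<Sum>A\<in>?\<pi>2. if A = B then phi \<beta> (real (card V) - 1) else 0)"
      by (intro sum.cong) (auto simp: eq)
    also have "\<dots> = (if B \<in> ?\<pi>2 then phi \<beta> (real (card V) - 1) else 0)"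
      using fin\<pi> by (subst sum.delta) auto
    also have "\<dots> = phi \<beta> (real (card V) - 1)"
    proof (cases "2 \<le> card B")
      \<comment> \<open>A singleton block never splits, but then \<open>V\<close> is that block and \<open>phi \<beta> 0 = 0\<close>.\<close>
      case False
      have "card V \<noteq> 0" "card V \<le> card B"
        using B finA[OF B(1)] V finite_subset[OF B(2)] by (auto intro: card_mono)
      then have "card V = 1" using False by linarith
      then show ?thesis using False phi_zero[OF \<beta>] by simp
    qed (use B in auto)
    finally show ?thesis by simp
  qed auto
  finally have off: "(\<Sum>\<rho>\<in>?S - {\<pi>}. splitting_rate \<beta> \<pi> \<rho> * ?f \<rho>) =
     (\<Sum>A\<in>?\<pi>2. phi \<beta> (real (card A) - 1)) * ?f \<pi> - phi \<beta> (real (card V) - 1) * ?f \<pi>" .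
  have "(\<Sum>\<rho>\<in>?S. splitting_rate \<beta> \<pi> \<rho> * ?f \<rho>) = splitting_rate \<beta> \<pi> \<pi> * ?f \<pi> + (\<Sum>\<rho>\<in>?S - {\<pi>}. splitting_rate \<beta> \<pi> \<rho> * ?f \<rho>)"
    using \<pi> finite_label_partitions by (subst sum.remove[of _ \<pi>]) auto
  then show ?thesis unfolding off by (simp add: splitting_rate_def)
qed

lemma transition_prob_together:
  assumes "\<beta> > -2" "V \<noteq> {}" "\<pi> \<in> label_partitions n"
  shows "(\<Sum>\<rho>\<in>label_partitions n. transition_prob (label_partitions n) (splitting_rate \<beta>) t \<pi> \<rho> * of_bool (together V \<rho>)) =
    exp (- t * phi \<beta> (real (card V) - 1)) * of_bool (together V \<pi>)"
  using transition_prob_eigenvector[OF finite_label_partitions splitting_rate_eigenvector[OF assms(1,2)] assms(3), of t]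
  by simp

text \<open>If \<open>A\<close> is the block around \<open>V\<close>, only the sets \<open>W\<close> between \<open>V\<close> and \<open>A\<close> contribute, and their
alternating sum is \<open>(1 - 1) ^ card (A - V)\<close>.\<close>

lemma of_bool_block_eq:
  assumes "\<pi> \<in> label_partitions n" "V \<subseteq> {1..n}" "V \<noteq> {}"
  shows "of_bool (V \<in> \<pi>) = (\<Sum>W\<in>{W. V \<subseteq> W \<and> W \<subseteq> {1..n}}. (- 1) ^ card (W - V) * of_bool (together W \<pi>) :: real)"
proof (cases "together V \<pi>")
  case False
  then have "\<not> together W \<pi>" if "V \<subseteq> W" for W using that by (auto simp: together_def)
  moreover have "V \<notin> \<pi>" using False by (auto simp: together_def)
  ultimately show ?thesis by simp
next
  case True
  then obtain A where A: "A \<in> \<pi>" "V \<subseteq> A" by (auto simp: together_def)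
  have d: "disjoint \<pi>" and An: "A \<subseteq> {1..n}" using assms A by (auto simp: label_partitions_def partition_on_def)
  have eq: "together W \<pi> \<longleftrightarrow> W \<subseteq> A" if "V \<subseteq> W" for W
  proof
    assume "together W \<pi>"
    then obtain B where B: "B \<in> \<pi>" "W \<subseteq> B" by (auto simp: together_def)
    then have "B \<inter> A \<noteq> {}" using that A assms(3) by auto
    then show "W \<subseteq> A" using disjointD[OF d B(1) A(1)] B by auto
  qed (use A in \<open>auto simp: together_def\<close>)
  have fA: "finite A" using An finite_subset by blast
  have "(\<Sum>W\<in>{W. V \<subseteq> W \<and> W \<subseteq> {1..n}}. (- 1) ^ card (W - V) * of_bool (together W \<pi>) :: real) =
     (\<Sum>W\<in>{W. V \<subseteq> W \<and> W \<subseteq> {1..n}}. if W \<subseteq> A then (- 1) ^ card (W - V) else 0)"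
    by (intro sum.cong) (auto simp: eq)
  also have "\<dots> = (\<Sum>W\<in>{W \<in> {W. V \<subseteq> W \<and> W \<subseteq> {1..n}}. W \<subseteq> A}. (- 1) ^ card (W - V))"
    by (subst sum.inter_filter) (auto intro: finite_subset[of _ "Pow {1..n}"])
  also have "\<dots> = (\<Sum>Z\<in>Pow (A - V). (- 1) ^ card Z)"
    by (rule sum.reindex_bij_witness[of _ "\<lambda>Z. V \<union> Z" "\<lambda>W. W - V"]) (use A An in \<open>auto simp: Un_absorb1 intro!: arg_cong[of _ _ "\<lambda>x. (- 1) ^ card x"]\<close>)
  also have "\<dots> = of_bool (A - V = {})"
    using sum_subsets_split[of "A - V" "{}" "- 1 :: real" 1] fA by (simp add: Pow_def power_0_left)
  also have "A - V = {} \<longleftrightarrow> V \<in> \<pi>"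
    using A disjointD[OF d A(1), of V] assms(3) by auto
  finally show ?thesis by simp
qed

section \<open>Law and paths of the tree\<close>

lemma (in prob_space) prob_finite_partition:
  assumes "finite S" "\<And>\<omega>. \<omega> \<in> space M \<Longrightarrow> Y \<omega> \<in> S"
    and "\<And>x. x \<in> S \<Longrightarrow> {\<omega>\<in>space M. Y \<omega> = x \<and> R \<omega>} \<in> events"
  shows "prob {\<omega>\<in>space M. P (Y \<omega>) \<and> R \<omega>} = (\<Sum>x\<in>S. of_bool (P x) * prob {\<omega>\<in>space M. Y \<omega> = x \<and> R \<omega>})"
proof -
  have "{\<omega>\<in>space M. P (Y \<omega>) \<and> R \<omega>} = (\<Union>x\<in>{x\<in>S. P x}. {\<omega>\<in>space M. Y \<omega> = x \<and> R \<omega>})"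
    using assms(2) by auto
  also have "prob \<dots> = (\<Sum>x\<in>{x\<in>S. P x}. prob {\<omega>\<in>space M. Y \<omega> = x \<and> R \<omega>})"
    using assms(1,3) by (intro finite_measure_finite_Union) (auto simp: disjoint_family_on_def)
  also have "\<dots> = (\<Sum>x\<in>S. of_bool (P x) * prob {\<omega>\<in>space M. Y \<omega> = x \<and> R \<omega>})"
    using assms(1) by (intro sum.mono_neutral_cong_left) auto
  finally show ?thesis .
qed

text \<open>The pathwise regularity that holds almost surely and on which all pathwise arguments rely. Refinement is
expressed through \<open>together\<close>, since that is the statistic whose law is known.\<close>

definition refining_path :: "nat \<Rightarrow> (real \<Rightarrow> nat set set) \<Rightarrow> bool" where
  "refining_path n p \<longleftrightarrow>
     (\<forall>t\<ge>0. p t \<in> label_partitions n) \<and>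
     (\<forall>t\<ge>0. \<forall>\<^sub>F s in at_right t. p s = p t) \<and>
     (\<forall>s t V. 0 \<le> s \<and> s \<le> t \<and> V \<noteq> {} \<and> together V (p t) \<longrightarrow> together V (p s)) \<and>
     (\<exists>t\<ge>0. \<forall>u\<in>{1..n}. {u} \<in> p t)"

lemma rational_right_of:
  fixes t :: real
  assumes "\<forall>\<^sub>F s in at_right t. P s" "t < b"
  obtains q where "q \<in> \<rat>" "t < q" "q < b" "P q"
proof -
  obtain c where c: "c > t" "\<And>s. t < s \<Longrightarrow> s < c \<Longrightarrow> P s"
    using assms(1) by (auto simp: eventually_at_right_field)
  obtain q where "q \<in> \<rat>" "t < q" "q < min b c"
    using Rats_dense_in_real[of t "min b c"] c(1) assms(2) by auto
  then show ?thesis using that[of q] c(2)[of q] by auto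
qed

locale beta_tree = prob_space M for M :: "'w measure" +
  fixes \<beta> :: real and n :: nat and X :: "real \<Rightarrow> 'w \<Rightarrow> nat set set"
  assumes \<beta>: "\<beta> > -2" and n: "n \<ge> 1" and tree: "beta_splitting_tree \<beta> n M X"
begin

lemma X_measurable: "t \<ge> 0 \<Longrightarrow> X t \<in> measurable M (count_space (label_partitions n))"
  using tree by (simp add: beta_splitting_tree_def finite_ctmc_def)

lemma X_in: "t \<ge> 0 \<Longrightarrow> \<omega> \<in> space M \<Longrightarrow> X t \<omega> \<in> label_partitions n"
  using measurable_space[OF X_measurable] by simp

lemma X_right_continuous: "t \<ge> 0 \<Longrightarrow> \<omega> \<in> space M \<Longrightarrow> \<forall>\<^sub>F s in at_right t. X s \<omega> = X t \<omega>"
  using tree by (simp add: beta_splitting_tree_def finite_ctmc_def)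

lemma X_pred: "t \<ge> 0 \<Longrightarrow> {\<omega>\<in>space M. P (X t \<omega>)} \<in> events"
proof -
  assume t: "t \<ge> 0"
  have "X t -` {x\<in>label_partitions n. P x} \<inter> space M \<in> events"
    by (rule measurable_sets[OF X_measurable[OF t]]) auto
  also have "X t -` {x\<in>label_partitions n. P x} \<inter> space M = {\<omega>\<in>space M. P (X t \<omega>)}"
    using X_in[OF t] by auto
  finally show ?thesis .
qed

lemma X_pred_conj: "s \<ge> 0 \<Longrightarrow> t \<ge> 0 \<Longrightarrow> {\<omega>\<in>space M. P (X s \<omega>) \<and> R (X t \<omega>)} \<in> events"
  using sets.Int[OF X_pred[of s P] X_pred[of t R]] by (simp add: Int_def conj_ac cong: conj_cong)

lemma prob_transition:
  assumes "0 \<le> s" "s \<le> t" "x \<in> label_partitions n" "y \<in> label_partitions n"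
  shows "prob {\<omega>\<in>space M. X s \<omega> = x \<and> X t \<omega> = y} =
    prob {\<omega>\<in>space M. X s \<omega> = x} * transition_prob (label_partitions n) (splitting_rate \<beta>) (t - s) x y"
proof -
  have "\<forall>(k::nat) \<tau> x t y.
        0 \<le> \<tau> 0 \<and> (\<forall>i<k. \<tau> i \<le> \<tau> (Suc i)) \<and> \<tau> k \<le> t \<and> (\<forall>i\<le>k. x i \<in> label_partitions n) \<and> y \<in> label_partitions n \<longrightarrow>
        prob {\<omega>\<in>space M. (\<forall>i\<le>k. X (\<tau> i) \<omega> = x i) \<and> X t \<omega> = y} =
        prob {\<omega>\<in>space M. \<forall>i\<le>k. X (\<tau> i) \<omega> = x i} * transition_prob (label_partitions n) (splitting_rate \<beta>) (t - \<tau> k) (x k) y"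
    using tree by (simp add: beta_splitting_tree_def finite_ctmc_def)
  from this[rule_format, of "\<lambda>_. s" 0 t "\<lambda>_. x" y] assms show ?thesis by simp
qed

text \<open>The eigenvector property in probabilistic form. It is used three times: without a condition, for the law
of \<open>together V\<close>; with \<open>P\<close> the negation of \<open>together V\<close>, to see that paths refine; and with \<open>P\<close> saying
that \<open>V\<close> is a block, for the exponential holding time of a block.\<close>

lemma prob_together_Markov:
  assumes "0 \<le> s" "s \<le> t" "V \<noteq> {}"
  shows "prob {\<omega>\<in>space M. P (X s \<omega>) \<and> together V (X t \<omega>)} =
    exp (- (t - s) * phi \<beta> (real (card V) - 1)) * prob {\<omega>\<in>space M. P (X s \<omega>) \<and> together V (X s \<omega>)}"
proof -
  let ?S = "label_partitions n"
  let ?e = "exp (- (t - s) * phi \<beta> (real (card V) - 1))"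
  have *: "prob {\<omega>\<in>space M. X s \<omega> = x \<and> together V (X t \<omega>)} = prob {\<omega>\<in>space M. X s \<omega> = x} * (?e * of_bool (together V x))"
    if x: "x \<in> ?S" for x
  proof -
    have "prob {\<omega>\<in>space M. together V (X t \<omega>) \<and> X s \<omega> = x} =
      (\<Sum>y\<in>?S. of_bool (together V y) * prob {\<omega>\<in>space M. X t \<omega> = y \<and> X s \<omega> = x})"
      using assms X_in by (intro prob_finite_partition finite_label_partitions X_pred_conj) auto
    also have "\<dots> = prob {\<omega>\<in>space M. X s \<omega> = x} * (\<Sum>y\<in>?S. transition_prob ?S (splitting_rate \<beta>) (t - s) x y * of_bool (together V y))"
      using prob_transition[OF assms(1,2) x] by (simp add: sum_distrib_left conj_commute mult_ac)
    also have "\<dots> = prob {\<omega>\<in>space M. X s \<omega> = x} * (?e * of_bool (together V x))"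
      unfolding transition_prob_together[OF \<beta> assms(3) x] ..
    finally show ?thesis by (simp add: conj_commute)
  qed
  have "prob {\<omega>\<in>space M. P (X s \<omega>) \<and> together V (X t \<omega>)} =
    (\<Sum>x\<in>?S. of_bool (P x) * prob {\<omega>\<in>space M. X s \<omega> = x \<and> together V (X t \<omega>)})"
    using assms X_in by (intro prob_finite_partition finite_label_partitions X_pred_conj) auto
  also have "\<dots> = ?e * (\<Sum>x\<in>?S. of_bool (P x \<and> together V x) * prob {\<omega>\<in>space M. X s \<omega> = x \<and> True})"
    by (simp add: * sum_distrib_left of_bool_conj mult_ac)
  also have "(\<Sum>x\<in>?S. of_bool (P x \<and> together V x) * prob {\<omega>\<in>space M. X s \<omega> = x \<and> True}) =
    prob {\<omega>\<in>space M. (P (X s \<omega>) \<and> together V (X s \<omega>)) \<and> True}"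
    using assms X_in by (intro prob_finite_partition[symmetric] finite_label_partitions X_pred_conj) auto
  finally show ?thesis by simp
qed

lemma prob_together:
  assumes "t \<ge> 0" "V \<subseteq> {1..n}" "V \<noteq> {}"
  shows "prob {\<omega>\<in>space M. together V (X t \<omega>)} = exp (- t * phi \<beta> (real (card V) - 1))"
proof -
  have "AE \<omega> in M. X 0 \<omega> = {{1..n}}"
    using tree by (simp add: beta_splitting_tree_def finite_ctmc_def)
  then have "prob {\<omega>\<in>space M. together V (X 0 \<omega>)} = 1"
    using X_pred[of 0] assms by (subst prob_Collect_eq_1) (auto simp: together_def)
  then show ?thesis using prob_together_Markov[of 0 t V "\<lambda>_. True"] assms by simp
qed

lemma prob_block:
  assumes "t \<ge> 0" "V \<subseteq> {1..n}" "V \<noteq> {}"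
  shows "prob {\<omega>\<in>space M. V \<in> X t \<omega>} =
    (\<Sum>W\<in>{W. V \<subseteq> W \<and> W \<subseteq> {1..n}}. (- 1) ^ card (W - V) * exp (- t * phi \<beta> (real (card W) - 1)))"
proof -
  let ?K = "{W. V \<subseteq> W \<and> W \<subseteq> {1..n}}"
  define E where "E W = {\<omega>\<in>space M. together W (X t \<omega>)}" for W
  have E: "E W \<in> events" "E W \<inter> space M = E W" for W
    using X_pred[OF assms(1)] by (auto simp: E_def)
  have "prob {\<omega>\<in>space M. V \<in> X t \<omega>} = expectation (indicator {\<omega>\<in>space M. V \<in> X t \<omega>})"
    by (simp add: Int_absorb2 Collect_restrict)
  also have "\<dots> = expectation (\<lambda>\<omega>. \<Sum>W\<in>?K. (- 1) ^ card (W - V) * indicator (E W) \<omega>)"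
  proof (intro Bochner_Integration.integral_cong refl)
    fix \<omega> assume \<omega>: "\<omega> \<in> space M"
    then show "indicator {\<omega>\<in>space M. V \<in> X t \<omega>} \<omega> = (\<Sum>W\<in>?K. (- 1) ^ card (W - V) * indicator (E W) \<omega> :: real)"
      using of_bool_block_eq[OF X_in[OF assms(1) \<omega>] assms(2,3)] by (simp add: indicator_def E_def)
  qed
  also have "\<dots> = (\<Sum>W\<in>?K. (- 1) ^ card (W - V) * prob (E W))"
    by (subst Bochner_Integration.integral_sum) (simp_all add: E emeasure_eq_measure)
  also have "\<dots> = (\<Sum>W\<in>?K. (- 1) ^ card (W - V) * exp (- t * phi \<beta> (real (card W) - 1)))"
    unfolding E_def using assms by (intro sum.cong refl arg_cong2[where f = "(*)"] prob_together) auto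
  finally show ?thesis .
qed

lemma AE_together_mono:
  assumes "0 \<le> s" "s \<le> t" "V \<noteq> {}"
  shows "AE \<omega> in M. together V (X t \<omega>) \<longrightarrow> together V (X s \<omega>)"
proof -
  have "prob {\<omega>\<in>space M. \<not> together V (X s \<omega>) \<and> together V (X t \<omega>)} = 0"
    by (subst prob_together_Markov[OF assms]) simp
  then show ?thesis
    using X_pred_conj[of s t "\<lambda>\<pi>. \<not> together V \<pi>" "together V"] assms
    by (subst (asm) prob_Collect_eq_0) (auto elim: AE_mp)
qed

lemma AE_eventually_apart:
  assumes "u \<in> {1..n}" "v \<in> {1..n}" "u \<noteq> v"
  shows "AE \<omega> in M. \<exists>m::nat. \<not> together {u, v} (X (real m) \<omega>)"
proof -
  let ?E = "{\<omega>\<in>space M. \<forall>m::nat. together {u, v} (X (real m) \<omega>)}"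
  have ev: "?E \<in> events" using X_pred by (intro sets.sets_Collect_countable_All) auto
  have "prob ?E \<le> exp (- real m * phi \<beta> 1)" for m :: nat
  proof -
    have "prob ?E \<le> prob {\<omega>\<in>space M. together {u, v} (X (real m) \<omega>)}"
      using X_pred[of m] by (intro finite_measure_mono) auto
    then show ?thesis using prob_together[of "real m" "{u, v}"] assms by simp
  qed
  moreover have "(\<lambda>m::nat. exp (- real m * phi \<beta> 1)) \<longlonglongrightarrow> 0"
  proof -
    have "phi \<beta> 1 > (0::real)" using phi_pos[OF \<beta>, of 1] by simp
    then have "(\<lambda>m::nat. exp (- phi \<beta> 1) ^ m) \<longlonglongrightarrow> (0::real)"
      by (intro LIMSEQ_realpow_zero) auto
    then show ?thesis by (simp flip: exp_of_nat_mult)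
  qed
  ultimately have "prob ?E \<le> 0" by (intro LIMSEQ_le_const) auto
  then have "prob ?E = 0" by (simp add: measure_le_0_iff)
  then show ?thesis using ev by (subst (asm) prob_Collect_eq_0) auto
qed

text \<open>There are countably many pairs of rational times and finitely many label sets, so almost surely no
rational pair violates refinement. Right-continuity extends this to all pairs of times. Any two labels are
eventually apart, and by refinement a common time works for all pairs.\<close>

lemma AE_refining_path: "AE \<omega> in M. refining_path n (\<lambda>t. X t \<omega>)"
proof -
  let ?Q = "\<rat> \<inter> {0::real..}"
  have Q: "countable ?Q" by (intro countable_Int1 countable_rat)
  have "AE \<omega> in M. \<forall>V\<in>Pow {1..n} - {{}}. \<forall>q\<in>?Q. \<forall>r\<in>?Q. q \<le> r \<longrightarrow> together V (X r \<omega>) \<longrightarrow> together V (X q \<omega>)"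
    unfolding AE_ball_countable[OF Q]
    by (subst AE_ball_countable) (use Q AE_together_mono in \<open>auto simp: AE_ball_countable[OF Q] countable_finite\<close>)
  moreover have "AE \<omega> in M. \<forall>u\<in>{1..n}. \<forall>v\<in>{1..n}. u \<noteq> v \<longrightarrow> (\<exists>m::nat. \<not> together {u, v} (X (real m) \<omega>))"
    using AE_eventually_apart by (auto simp: AE_ball_countable countable_finite)
  moreover note AE_space
  ultimately show ?thesis
  proof eventually_elim
    case (elim \<omega>)
    have mono: "together V (X s \<omega>)" if st: "0 \<le> s" "s \<le> t" "V \<noteq> {}" "together V (X t \<omega>)" for s t V
    proof (cases "s = t")
      case False
      have t0: "0 \<le> t" using st by simp
      obtain r where r: "r \<in> \<rat>" "t < r" "X r \<omega> = X t \<omega>"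
        using rational_right_of[OF X_right_continuous[OF t0 elim(3)], of "t + 1"] by auto
      obtain q where q: "q \<in> \<rat>" "s < q" "q < t" "X q \<omega> = X s \<omega>"
        using rational_right_of[OF X_right_continuous[OF st(1) elim(3)], of t] False st(2) by auto
      have "V \<subseteq> {1..n}" using X_in[OF t0 elim(3)] st(4)
        by (auto simp: label_partitions_def partition_on_def together_def)
      then have "together V (X q \<omega>)" using elim(1)[rule_format, of V q r] q r st by auto
      then show ?thesis by (simp add: q)
    qed (use st in simp)
    obtain m :: "nat \<Rightarrow> nat \<Rightarrow> nat" where m: "\<not> together {u, v} (X (real (m u v)) \<omega>)" if "u \<in> {1..n}" "v \<in> {1..n}" "u \<noteq> v" for u v
      using elim(2) by metis
    define T where "T = (\<Sum>u\<in>{1..n}. \<Sum>v\<in>{1..n}. m u v)"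
    have "{u} \<in> X (real T) \<omega>" if u: "u \<in> {1..n}" for u
    proof -
      have "partition_on {1..n} (X (real T) \<omega>)" using X_in[of "real T"] elim(3) by (auto simp: label_partitions_def)
      then have Un: "\<Union>(X (real T) \<omega>) = {1..n}" by (simp add: partition_on_def)
      with u obtain A where "A \<in> X (real T) \<omega>" "u \<in> A" by blast
      with Un have A: "A \<in> X (real T) \<omega>" "u \<in> A" "A \<subseteq> {1..n}" by auto
      have "v = u" if v: "v \<in> A" for v
      proof (rule ccontr)
        assume "v \<noteq> u"
        have vn: "v \<in> {1..n}" using A v by auto
        have "m u v \<le> (\<Sum>v\<in>{1..n}. m u v)" using vn by (intro member_le_sum) auto
        also have "\<dots> \<le> T" unfolding T_def using u by (intro member_le_sum[of u _ "\<lambda>u. \<Sum>v\<in>{1..n}. m u v"]) auto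
        finally have "m u v \<le> T" .
        moreover have "together {u, v} (X (real T) \<omega>)" using A v by (auto simp: together_def)
        ultimately have "together {u, v} (X (real (m u v)) \<omega>)" by (intro mono[of "real (m u v)" "real T"]) auto
        then show False using m[OF u vn] \<open>v \<noteq> u\<close> by auto
      qed
      then have "A = {u}" using A(2) by blast
      then show ?thesis using A by simp
    qed
    then have "\<exists>t\<ge>0. \<forall>u\<in>{1..n}. {u} \<in> X t \<omega>" by (intro exI[of _ "real T"]) simp
    moreover have "\<forall>s t V. 0 \<le> s \<and> s \<le> t \<and> V \<noteq> {} \<and> together V (X t \<omega>) \<longrightarrow> together V (X s \<omega>)"
      by (intro allI impI) (elim conjE, rule mono)
    ultimately show ?case
      unfolding refining_path_def by (simp add: X_in X_right_continuous elim(3))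
  qed
qed

end

section \<open>A leaf along a single refining path\<close>

locale refining =
  fixes n :: nat and p :: "real \<Rightarrow> nat set set" and u :: nat
  assumes refining: "refining_path n p" and u: "u \<in> {1..n}"
begin

abbreviation b :: "real \<Rightarrow> nat set" where "b t \<equiv> block_of (p t) u"

lemma partition: "t \<ge> 0 \<Longrightarrow> partition_on {1..n} (p t)"
  using refining by (simp add: refining_path_def label_partitions_def)

lemma block_eqI: "t \<ge> 0 \<Longrightarrow> V \<in> p t \<Longrightarrow> u \<in> V \<Longrightarrow> b t = V"
  unfolding block_of_def using partition[of t]
  by (intro the_equality) (auto simp: partition_on_def disjoint_def)

lemma block_in: assumes "t \<ge> 0" shows "b t \<in> p t" "u \<in> b t"
proof -
  have "u \<in> \<Union>(p t)" using partition[OF assms] u by (simp add: partition_on_def)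
  then obtain V where "V \<in> p t" "u \<in> V" by blast
  then show "b t \<in> p t" "u \<in> b t" using block_eqI[OF assms] by simp_all
qed

lemma block_subset: "t \<ge> 0 \<Longrightarrow> b t \<subseteq> {1..n}"
  using partition[of t] block_in[of t] by (auto simp: partition_on_def)

lemma finite_block: "t \<ge> 0 \<Longrightarrow> finite (b t)"
  using block_subset finite_subset by blast

lemma card_block: assumes "t \<ge> 0" shows "1 \<le> card (b t)" "card (b t) \<le> n"
proof -
  show "1 \<le> card (b t)" using finite_block[OF assms] block_in[OF assms] by (auto simp: Suc_le_eq card_gt_0_iff)
  show "card (b t) \<le> n" using card_mono[OF _ block_subset[OF assms]] by simp
qed

lemma block_subset_of_together:
  assumes "t \<ge> 0" "u \<in> V" "together V (p t)" shows "V \<subseteq> b t"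
  using assms block_eqI by (auto simp: together_def)

lemma block_antimono:
  assumes "0 \<le> s" "s \<le> t" shows "b t \<subseteq> b s"
proof (rule block_subset_of_together)
  have "together (b t) (p t)" using block_in[of t] assms by (auto simp: together_def)
  moreover have "b t \<noteq> {}" using block_in(2)[of t] assms by auto
  ultimately show "together (b t) (p s)" using refining assms unfolding refining_path_def by blast
qed (use assms block_in[of t] in auto)

lemma card_block_antimono: "0 \<le> s \<Longrightarrow> s \<le> t \<Longrightarrow> card (b t) \<le> card (b s)"
  by (rule card_mono[OF finite_block block_antimono])

lemma block_eq_of_card_eq: "0 \<le> s \<Longrightarrow> s \<le> t \<Longrightarrow> card (b s) = card (b t) \<Longrightarrow> b t = b s"
  by (intro card_subset_eq finite_block block_antimono) auto

lemma block_right_continuous: "t \<ge> 0 \<Longrightarrow> \<forall>\<^sub>F s in at_right t. b s = b t"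
proof -
  assume "t \<ge> 0"
  then have "\<forall>\<^sub>F s in at_right t. p s = p t" using refining by (simp add: refining_path_def)
  then show ?thesis by eventually_elim simp
qed

lemma singleton_iff: assumes t: "t \<ge> 0" shows "{u} \<in> p t \<longleftrightarrow> card (b t) = 1"
proof
  assume "{u} \<in> p t"
  then have "b t = {u}" using block_eqI[OF t] by simp
  then show "card (b t) = 1" by simp
next
  assume "card (b t) = 1"
  then obtain v where "b t = {v}" by (rule card_1_singletonE)
  then have "b t = {u}" using block_in(2)[OF t] by simp
  then show "{u} \<in> p t" using block_in(1)[OF t] by simp
qed

lemma eventually_singleton: "\<exists>T\<ge>0. card (b T) = 1"
proof -
  obtain T where "T \<ge> 0" "\<forall>v\<in>{1..n}. {v} \<in> p T" using refining unfolding refining_path_def by blast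
  then show ?thesis using singleton_iff[of T] u by blast
qed

text \<open>The set of times at which the block has size \<open>j\<close> is convex because sizes decrease, bounded because
singletons are reached eventually (here \<open>j \<ge> 2\<close> enters), contains its infimum and omits its supremum
by right-continuity.\<close>

lemma level_set_interval:
  assumes j: "j \<ge> 2" and vis: "\<exists>t\<ge>0. card (b t) = j"
  obtains a c where "0 \<le> a" "a < c" "{t. 0 \<le> t \<and> card (b t) = j} = {a..<c}"
proof -
  define I where "I = {t. 0 \<le> t \<and> card (b t) = j}"
  have conv: "t \<in> I" if "s \<in> I" "r \<in> I" "s \<le> t" "t \<le> r" for s t r
    using card_block_antimono[of s t] card_block_antimono[of t r] that by (auto simp: I_def)
  have right: "\<exists>c>t. \<forall>s. t < s \<and> s < c \<longrightarrow> (s \<in> I \<longleftrightarrow> t \<in> I)" if t0: "t \<ge> 0" for t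
  proof -
    obtain c where "c > t" "\<And>s. t < s \<Longrightarrow> s < c \<Longrightarrow> b s = b t"
      using block_right_continuous[OF t0] by (auto simp: eventually_at_right_field)
    then show ?thesis using t0 by (intro exI[of _ c]) (auto simp: I_def)
  qed
  have ne: "I \<noteq> {}" using vis by (auto simp: I_def)
  obtain T where T: "T \<ge> 0" "card (b T) = 1" using eventually_singleton by auto
  have ub: "t \<le> T" if "t \<in> I" for t
    using card_block_antimono[of T t] that T j by (cases "t \<le> T") (auto simp: I_def)
  have bdd: "bdd_above I" "bdd_below I" using ub by (auto simp: bdd_above_def bdd_below_def I_def)
  define a where "a = Inf I"
  define c where "c = Sup I"
  have a0: "0 \<le> a" unfolding a_def using ne by (intro cInf_greatest) (auto simp: I_def)
  have aI: "a \<in> I"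
  proof -
    obtain d where d: "d > a" "\<And>s. a < s \<Longrightarrow> s < d \<Longrightarrow> s \<in> I \<longleftrightarrow> a \<in> I" using right[OF a0] by auto
    obtain s where "s \<in> I" "s < d" using cInf_lessD[OF ne] d(1) by (auto simp: a_def)
    moreover have "a \<le> s" unfolding a_def using \<open>s \<in> I\<close> bdd by (intro cInf_lower)
    ultimately show ?thesis using d(2)[of s] by (cases "s = a") auto
  qed
  have ac: "a \<le> c" unfolding c_def using aI bdd by (intro cSup_upper)
  have cI: "c \<notin> I"
  proof
    assume cI: "c \<in> I"
    obtain d where d: "d > c" "\<And>s. c < s \<Longrightarrow> s < d \<Longrightarrow> s \<in> I \<longleftrightarrow> c \<in> I" using right[of c] a0 ac by auto
    have "(c + d) / 2 \<in> I" using d(2)[of "(c + d) / 2"] d(1) cI by simp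
    then have "(c + d) / 2 \<le> c" unfolding c_def using bdd by (intro cSup_upper)
    then show False using d(1) by simp
  qed
  have "I = {a..<c}"
  proof (intro equalityI subsetI)
    fix t assume t: "t \<in> I"
    then have "a \<le> t" "t \<le> c" using bdd by (auto simp: a_def c_def intro: cInf_lower cSup_upper)
    moreover have "t \<noteq> c" using cI t by auto
    ultimately show "t \<in> {a..<c}" by auto
  next
    fix t assume t: "t \<in> {a..<c}"
    then obtain r where "r \<in> I" "t < r" using less_cSupD[OF ne, of t] by (auto simp: c_def)
    then show "t \<in> I" using conv[OF aI, of r t] t by auto
  qed
  moreover have "a < c" using ac aI cI by (cases "a = c") auto
  ultimately show ?thesis using that[of a c] a0 by (simp add: I_def)
qed

lemma less_cont_height_iff:
  assumes t: "t \<ge> 0" shows "ennreal t < cont_height p u \<longleftrightarrow> card (b t) \<noteq> 1"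
proof
  assume l: "ennreal t < cont_height p u"
  have "cont_height p u \<le> ennreal t" if "{u} \<in> p t"
    unfolding cont_height_def using that t by (intro INF_lower) auto
  then show "card (b t) \<noteq> 1" using l singleton_iff[OF t] by auto
next
  assume c: "card (b t) \<noteq> 1"
  obtain d where d: "d > t" "\<And>s. t < s \<Longrightarrow> s < d \<Longrightarrow> b s = b t"
    using block_right_continuous[OF t] by (auto simp: eventually_at_right_field)
  have "ennreal d \<le> cont_height p u"
    unfolding cont_height_def
  proof (rule INF_greatest)
    fix s assume "s \<in> {t. 0 \<le> t \<and> {u} \<in> p t}"
    then have s: "0 \<le> s" "card (b s) = 1" using singleton_iff by auto
    have "d \<le> s"
    proof (rule ccontr)
      assume "\<not> d \<le> s"
      then have "s \<le> t" using d(2)[of s] s c by (cases "s \<le> t") auto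
      then have "card (b t) \<le> 1" using card_block_antimono[of s t] s by simp
      then show False using c card_block(1)[OF t] by simp
    qed
    then show "ennreal d \<le> ennreal s" by (rule ennreal_leI)
  qed
  then show "ennreal t < cont_height p u"
    using d(1) t by (metis ennreal_lessI less_le_trans order_le_less_trans)
qed

text \<open>The size is a decreasing function with natural values, so it is constant, equal to its minimum over
\<open>[0, t)\<close>, just before \<open>t\<close>. A change of the block at \<open>t\<close> then forces a strictly smaller size at \<open>t\<close>.\<close>

lemma jump_time_cases:
  assumes t: "0 < t" "\<not> (\<forall>\<^sub>F s in at_left t. b s = b t)"
  obtains j s where "j \<in> {2..n}" "0 \<le> s" "s < t" "card (b t) < j" "\<And>r. s \<le> r \<Longrightarrow> r < t \<Longrightarrow> card (b r) = j"
proof -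
  define j where "j = (LEAST m. \<exists>s. 0 \<le> s \<and> s < t \<and> card (b s) = m)"
  have "\<exists>s. 0 \<le> s \<and> s < t \<and> card (b s) = j"
    unfolding j_def by (rule LeastI[of _ "card (b 0)"]) (use t in auto)
  then obtain s where s: "0 \<le> s" "s < t" "card (b s) = j" by auto
  have const: "card (b r) = j" if "s \<le> r" "r < t" for r
  proof -
    have "j \<le> card (b r)" unfolding j_def by (rule Least_le, rule exI[of _ r]) (use that s in simp)
    then show ?thesis using card_block_antimono[of s r] that s by auto
  qed
  have "card (b t) \<noteq> j"
  proof
    assume e: "card (b t) = j"
    have "b r = b t" if "s < r" "r < t" for r
      using block_eq_of_card_eq[of r t] const[of r] that s e by auto
    then have "\<forall>\<^sub>F r in at_left t. b r = b t"
      using s(2) by (auto simp: eventually_at_left_field)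
    then show False using t by simp
  qed
  moreover have "card (b t) \<le> j" using card_block_antimono[of s t] s by auto
  ultimately have "card (b t) < j" by simp
  moreover have "j \<in> {2..n}" using calculation card_block(1)[of t] card_block(2)[of s] t s by auto
  ultimately show ?thesis using that s const by blast
qed

text \<open>Sending a visited size \<open>j \<ge> 2\<close> to the end of its interval is a bijection onto the jump times up to
the height. All jumps of the block of the leaf take place by then.\<close>

lemma discrete_height_eq: "discrete_height p u = card {j\<in>{2..n}. \<exists>t\<ge>0. card (b t) = j}"
proof -
  define I where "I j = {t. 0 \<le> t \<and> card (b t) = j}" for j
  let ?V = "{j\<in>{2..n}. \<exists>t\<ge>0. card (b t) = j}"
  let ?J = "{t. 0 < t \<and> ennreal t \<le> cont_height p u \<and> \<not> (\<forall>\<^sub>F s in at_left t. b s = b t)}"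
  have int: "\<exists>a c. 0 \<le> a \<and> a < c \<and> I j = {a..<c}" if "j \<in> ?V" for j
  proof -
    have "2 \<le> j" "\<exists>t\<ge>0. card (b t) = j" using that by auto
    then obtain a c where "0 \<le> a" "a < c" "{t. 0 \<le> t \<and> card (b t) = j} = {a..<c}"
      by (rule level_set_interval)
    then show ?thesis unfolding I_def by blast
  qed
  have "bij_betw (\<lambda>j. Sup (I j)) ?V ?J"
    unfolding bij_betw_def
  proof (intro conjI inj_onI equalityI subsetI)
    fix j k assume j: "j \<in> ?V" and k: "k \<in> ?V" and eq: "Sup (I j) = Sup (I k)"
    obtain a c where ac: "a < c" "I j = {a..<c}" using int[OF j] by auto
    obtain a' c' where ac': "a' < c'" "I k = {a'..<c'}" using int[OF k] by auto
    have "c = c'" using eq ac ac' by simp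
    then have "max a a' \<in> I j \<inter> I k" using ac ac' by auto
    then show "j = k" by (auto simp: I_def)
  next
    fix t assume "t \<in> (\<lambda>j. Sup (I j)) ` ?V"
    then obtain j where j: "j \<in> ?V" "t = Sup (I j)" by auto
    obtain a c where ac: "0 \<le> a" "a < c" "I j = {a..<c}" using int[OF j(1)] by auto
    have tc: "t = c" using j ac by simp
    have "card (b c) \<noteq> j"
    proof
      assume "card (b c) = j"
      then have "c \<in> I j" using ac by (auto simp: I_def)
      then show False using ac by simp
    qed
    have mem: "card (b s) = j" if "a \<le> s" "s < c" for s
    proof -
      have "s \<in> I j" using ac that by simp
      then show ?thesis by (simp add: I_def)
    qed
    have "\<not> (\<forall>\<^sub>F s in at_left c. b s = b c)"
    proof
      assume "\<forall>\<^sub>F s in at_left c. b s = b c"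
      moreover have "\<forall>\<^sub>F s in at_left c. card (b s) = j"
        using mem ac by (auto simp: eventually_at_left_field intro!: exI[of _ a])
      ultimately have "\<forall>\<^sub>F s in at_left c. False"
        by eventually_elim (use \<open>card (b c) \<noteq> j\<close> in auto)
      then show False by simp
    qed
    moreover have "ennreal c \<le> cont_height p u"
      unfolding cont_height_def
    proof (rule INF_greatest)
      fix s assume "s \<in> {t. 0 \<le> t \<and> {u} \<in> p t}"
      then have s: "0 \<le> s" "card (b s) = 1" using singleton_iff by auto
      have "c \<le> s"
      proof (rule ccontr)
        assume "\<not> c \<le> s"
        then have "card (b (max a s)) = j" using ac by (intro mem) auto
        moreover have "card (b (max a s)) \<le> card (b s)" using s by (intro card_block_antimono) auto
        ultimately show False using s j by auto
      qed
      then show "ennreal c \<le> ennreal s" by (rule ennreal_leI)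
    qed
    ultimately show "t \<in> ?J" using ac tc by auto
  next
    fix t assume t: "t \<in> ?J"
    then obtain j s where j: "j \<in> {2..n}" "0 \<le> s" "s < t" "card (b t) < j" "\<And>r. s \<le> r \<Longrightarrow> r < t \<Longrightarrow> card (b r) = j"
      using jump_time_cases[of t] by blast
    have jV: "j \<in> ?V" using j(1,2) j(5)[of s] j(3) by auto
    obtain a c where ac: "0 \<le> a" "a < c" "I j = {a..<c}" using int[OF jV] by auto
    have sub: "r \<in> {a..<c}" if "s \<le> r" "r < t" for r
      using j(5)[OF that] that j(2) unfolding ac(3)[symmetric] by (simp add: I_def)
    have "t \<notin> {a..<c}" using j(4) unfolding ac(3)[symmetric] by (simp add: I_def)
    then have "c \<le> t" using sub[of s] j(3) by auto
    moreover have "t \<le> c" using sub[of "max c s"] j(3) by (cases "c < t") auto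
    ultimately have "t = Sup (I j)" using ac by simp
    then show "t \<in> (\<lambda>j. Sup (I j)) ` ?V" using jV by blast
  qed
  then show ?thesis unfolding discrete_height_def by (rule bij_betw_same_card[symmetric])
qed

text \<open>With \<open>[a, c)\<close> the interval of times at size \<open>j\<close> and \<open>h = 1 / (m + 1)\<close>, the set of \<open>t\<close> counted here is
\<open>[max a (c - h), c)\<close>, of length \<open>min (c - a) h\<close>.\<close>

lemma exit_window:
  assumes j: "j \<ge> 2"
  shows "(\<lambda>m. ennreal (real (Suc m)) * (\<integral>\<^sup>+t\<in>{0..}. ennreal (of_bool (card (b t) = j \<and> card (b (t + 1 / real (Suc m))) \<noteq> j)) \<partial>lborel))
      \<longlonglongrightarrow> indicator {j. \<exists>t\<ge>0. card (b t) = j} j" (is "?R \<longlonglongrightarrow> _")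
    and "ennreal (real (Suc m)) * (\<integral>\<^sup>+t\<in>{0..}. ennreal (of_bool (card (b t) = j \<and> card (b (t + 1 / real (Suc m))) \<noteq> j)) \<partial>lborel) \<le> 1"
proof -
  have *: "?R \<longlonglongrightarrow> indicator {j. \<exists>t\<ge>0. card (b t) = j} j \<and> (\<forall>m. ?R m \<le> 1)"
  proof (cases "\<exists>t\<ge>0. card (b t) = j")
    case False
    have "?R m = 0" for m
    proof -
      have "(\<integral>\<^sup>+t\<in>{0..}. ennreal (of_bool (card (b t) = j \<and> card (b (t + 1 / real (Suc m))) \<noteq> j)) \<partial>lborel) = (\<integral>\<^sup>+t. 0 \<partial>(lborel :: real measure))"
        using False by (intro nn_integral_cong) (auto simp: indicator_def)
      then show ?thesis by simp
    qed
    then show ?thesis using False by simp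
  next
    case True
    then obtain a c where ac: "0 \<le> a" "a < c" "{t. 0 \<le> t \<and> card (b t) = j} = {a..<c}"
      using level_set_interval[OF j] by metis
    have mem: "card (b t) = j \<longleftrightarrow> a \<le> t \<and> t < c" if "0 \<le> t" for t
      using ac(3) that by (auto simp: set_eq_iff)
    have R: "?R m = ennreal (min (real (Suc m) * (c - a)) 1)" for m
    proof -
      let ?h = "1 / real (Suc m)"
      have "(\<integral>\<^sup>+t\<in>{0..}. ennreal (of_bool (card (b t) = j \<and> card (b (t + ?h)) \<noteq> j)) \<partial>lborel) =
        (\<integral>\<^sup>+t. indicator {max a (c - ?h)..<c} t \<partial>lborel)"
      proof (intro nn_integral_cong)
        fix t :: real
        define h where "h = 1 / real (Suc m)"
        have "0 < h" by (simp add: h_def)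
        then show "ennreal (of_bool (card (b t) = j \<and> card (b (t + ?h)) \<noteq> j)) * indicator {0..} t = indicator {max a (c - ?h)..<c} t"
          unfolding h_def[symmetric] using mem[of t] mem[of "t + h"] ac(1) by (auto simp: indicator_def)
      qed
      also have "\<dots> = ennreal (c - max a (c - ?h))" using ac by simp
      finally have "?R m = ennreal (real (Suc m) * (c - max a (c - ?h)))" using ac by (simp add: ennreal_mult)
      also have "c - max a (c - ?h) = min (c - a) ?h" by (simp add: max_def min_def)
      also have "real (Suc m) * min (c - a) ?h = min (real (Suc m) * (c - a)) 1"
        by (simp add: min_def field_simps)
      finally show ?thesis .
    qed
    have "\<forall>\<^sub>F m in sequentially. ?R m = 1"
    proof -
      obtain k :: nat where k: "1 / (c - a) < real k" using reals_Archimedean2 by blast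
      have "?R m = 1" if "m \<ge> k" for m
      proof -
        have "1 / (c - a) < real (Suc m)" using k that by simp
        then have "1 < real (Suc m) * (c - a)" using ac(2) by (simp add: pos_divide_less_eq)
        then show ?thesis unfolding R by (simp add: min_def)
      qed
      then show ?thesis unfolding eventually_sequentially by blast
    qed
    then have "?R \<longlonglongrightarrow> 1" by (rule tendsto_eventually)
    moreover have "?R m \<le> 1" for m unfolding R by (metis ennreal_1 ennreal_leI min.cobounded2)
    ultimately show ?thesis using True by simp
  qed
  from * show "?R \<longlonglongrightarrow> indicator {j. \<exists>t\<ge>0. card (b t) = j} j" by (rule conjunct1)
  from * show "?R m \<le> 1" by blast
qed

end

section \<open>Integration over time and comparison of tails\<close>

text \<open>Approximation from the right by step functions in time: \<open>t\<close> is replaced by the next point strictly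
after it in the grid of mesh \<open>1 / (i + 1)\<close>. Times are clipped at \<open>0\<close> so that the function is defined on the
whole line.\<close>

lemma right_continuous_joint_measurable:
  fixes g :: "real \<Rightarrow> 'a \<Rightarrow> real"
  assumes meas: "\<And>t. t \<ge> 0 \<Longrightarrow> g t \<in> borel_measurable M"
    and rc: "\<And>t \<omega>. t \<ge> 0 \<Longrightarrow> \<omega> \<in> space M \<Longrightarrow> ((\<lambda>s. g s \<omega>) \<longlongrightarrow> g t \<omega>) (at_right t)"
  shows "(\<lambda>(t, \<omega>). g (max 0 t) \<omega>) \<in> borel_measurable (lborel \<Otimes>\<^sub>M M)"
proof (rule borel_measurable_LIMSEQ_metric)
  let ?k = "\<lambda>i (t::real). nat \<lfloor>real (Suc i) * max 0 t\<rfloor>"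
  let ?\<tau> = "\<lambda>i t. real (Suc (?k i t)) / real (Suc i)"
  fix i
  have "(\<lambda>x. (\<lambda>k x. g (real (Suc k) / real (Suc i)) (snd x)) (?k i (fst x)) x) \<in> borel_measurable (lborel \<Otimes>\<^sub>M M)"
    by (rule measurable_compose_countable) (use meas in measurable)
  then show "(\<lambda>(t, \<omega>). g (?\<tau> i t) \<omega>) \<in> borel_measurable (lborel \<Otimes>\<^sub>M M)"
    by (simp add: case_prod_beta)
next
  let ?k = "\<lambda>i (t::real). nat \<lfloor>real (Suc i) * max 0 t\<rfloor>"
  let ?\<tau> = "\<lambda>i t. real (Suc (?k i t)) / real (Suc i)"
  fix x :: "real \<times> 'a" assume "x \<in> space (lborel \<Otimes>\<^sub>M M)"
  then obtain t \<omega> where x: "x = (t, \<omega>)" "\<omega> \<in> space M" by (auto simp: space_pair_measure)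
  let ?t = "max 0 t"
  have eq: "real (?k i t) = of_int \<lfloor>real (Suc i) * ?t\<rfloor>" for i
    by (subst of_nat_nat) auto
  have gt: "?t < ?\<tau> i t" for i
  proof -
    have "real (Suc i) * ?t < of_int \<lfloor>real (Suc i) * ?t\<rfloor> + 1" by linarith
    then have "?t * real (Suc i) < real (Suc (?k i t))"
      using eq[of i] by (simp only: of_nat_Suc mult.commute add.commute)
    then show ?thesis by (simp only: pos_less_divide_eq of_nat_0_less_iff zero_less_Suc)
  qed
  have le: "?\<tau> i t \<le> ?t + 1 / real (Suc i)" for i
  proof -
    have "of_int \<lfloor>real (Suc i) * ?t\<rfloor> + 1 \<le> real (Suc i) * ?t + 1" by linarith
    then show ?thesis using eq[of i] by (simp add: pos_divide_le_eq algebra_simps)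
  qed
  have "(\<lambda>i. ?\<tau> i t) \<longlonglongrightarrow> ?t"
  proof (rule tendsto_sandwich[of "\<lambda>_. ?t" _ _ "\<lambda>i. ?t + 1 / real (Suc i)"])
    show "(\<lambda>i. ?t + 1 / real (Suc i)) \<longlonglongrightarrow> ?t"
      using tendsto_add[OF tendsto_const LIMSEQ_inverse_real_of_nat] by (simp add: inverse_eq_divide)
  qed (use gt le in \<open>auto intro!: always_eventually less_imp_le\<close>)
  then have "filterlim (\<lambda>i. ?\<tau> i t) (at_right ?t) sequentially"
    using gt by (intro filterlim_at_withinI) (auto simp: less_imp_neq[symmetric])
  then have "(\<lambda>i. g (?\<tau> i t) \<omega>) \<longlonglongrightarrow> g ?t \<omega>"
    using rc[of ?t \<omega>] x by (auto intro: filterlim_compose)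
  then show "(\<lambda>i. case x of (t, \<omega>) \<Rightarrow> g (?\<tau> i t) \<omega>) \<longlonglongrightarrow> (case x of (t, \<omega>) \<Rightarrow> g (max 0 t) \<omega>)"
    by (simp add: x)
qed

text \<open>Tonelli for right-continuous processes, which are jointly measurable.\<close>

lemma nn_integral_time_swap:
  fixes g :: "real \<Rightarrow> 'a \<Rightarrow> real"
  assumes "sigma_finite_measure M"
    and meas: "\<And>t. t \<ge> 0 \<Longrightarrow> g t \<in> borel_measurable M"
    and rc: "\<And>t \<omega>. t \<ge> 0 \<Longrightarrow> \<omega> \<in> space M \<Longrightarrow> ((\<lambda>s. g s \<omega>) \<longlongrightarrow> g t \<omega>) (at_right t)"
  shows "(\<integral>\<^sup>+\<omega>. (\<integral>\<^sup>+t\<in>{0..}. ennreal (g t \<omega>) \<partial>lborel) \<partial>M) = (\<integral>\<^sup>+t\<in>{0..}. (\<integral>\<^sup>+\<omega>. ennreal (g t \<omega>) \<partial>M) \<partial>lborel)"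
proof -
  interpret sigma_finite_measure M by fact
  interpret P: pair_sigma_finite lborel M ..
  let ?f = "\<lambda>t \<omega>. ennreal (g (max 0 t) \<omega>) * indicator {0..} t"
  have m: "(\<lambda>x. g (max 0 (fst x)) (snd x)) \<in> borel_measurable (lborel \<Otimes>\<^sub>M M)"
    using right_continuous_joint_measurable[OF meas rc] by (simp add: case_prod_beta)
  have "case_prod ?f \<in> borel_measurable (lborel \<Otimes>\<^sub>M M)"
    unfolding case_prod_beta using m by measurable
  then have "(\<integral>\<^sup>+\<omega>. \<integral>\<^sup>+t. ?f t \<omega> \<partial>lborel \<partial>M) = (\<integral>\<^sup>+t. \<integral>\<^sup>+\<omega>. ?f t \<omega> \<partial>M \<partial>lborel)"
    by (rule P.Fubini')
  moreover have "(\<integral>\<^sup>+\<omega>. ?f t \<omega> \<partial>M) = (\<integral>\<^sup>+\<omega>. ennreal (g t \<omega>) \<partial>M) * indicator {0..} t" for t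
    by (simp add: indicator_def)
  moreover have "(\<integral>\<^sup>+t. ?f t \<omega> \<partial>lborel) = (\<integral>\<^sup>+t\<in>{0..}. ennreal (g t \<omega>) \<partial>lborel)" for \<omega>
    by (intro nn_integral_cong) (simp add: indicator_def)
  ultimately show ?thesis by simp
qed

lemma emeasure_lborel_atLeast: "emeasure lborel {a::real..} = \<infinity>"
proof -
  have "of_nat k \<le> emeasure lborel {a..}" for k :: nat
  proof -
    have "of_nat k = emeasure lborel {a..a + real k}" by (simp add: ennreal_of_nat_eq_real_of_nat)
    also have "\<dots> \<le> emeasure lborel {a..}" by (intro emeasure_mono) auto
    finally show ?thesis .
  qed
  then show ?thesis using ennreal_Ex_less_of_nat[of "emeasure lborel {a..}"]
    by (metis infinity_ennreal_def less_top not_less)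
qed

lemma nn_integral_less_height:
  fixes c :: ennreal
  shows "(\<integral>\<^sup>+t\<in>{0..}. indicator {t. ennreal t < c} t \<partial>lborel) = c"
proof (cases c)
  case (real r)
  have "(\<integral>\<^sup>+t\<in>{0..}. indicator {t. ennreal t < c} t \<partial>lborel) = (\<integral>\<^sup>+t. indicator {0..<r} t \<partial>lborel)"
    using real by (intro nn_integral_cong) (auto simp: indicator_def ennreal_less_iff)
  then show ?thesis using real by simp
next
  case top
  have "(\<integral>\<^sup>+t\<in>{0..}. indicator {t. ennreal t < c} t \<partial>lborel) = (\<integral>\<^sup>+t. indicator {0::real..} t \<partial>lborel)"
    using top by (intro nn_integral_cong) (auto simp: indicator_def)
  then show ?thesis using top emeasure_lborel_atLeast by simp
qed

text \<open>The sets \<open>{..a}\<close> are stable under intersection and generate the Borel sets; the one with \<open>a = \<top>\<close> is the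
whole space, so that no tail at infinity has to be compared.\<close>

lemma distr_ennreal_eqI:
  assumes "prob_space M" "prob_space N" "Y \<in> borel_measurable M" "Z \<in> borel_measurable N"
    and tail: "\<And>t. t \<ge> 0 \<Longrightarrow> measure M {\<omega>\<in>space M. ennreal t < Y \<omega>} = measure N {\<omega>\<in>space N. ennreal t < Z \<omega>}"
  shows "distr M borel Y = distr N borel Z"
proof -
  interpret M: prob_space M by fact
  interpret N: prob_space N by fact
  interpret DM: prob_space "distr M borel Y" by (rule M.prob_space_distr) fact
  interpret DN: prob_space "distr N borel Z" by (rule N.prob_space_distr) fact
  have borel: "sets (borel :: ennreal measure) = sigma_sets UNIV (range atMost)"
  proof -
    have "sets (borel :: ennreal measure) = sigma_sets UNIV (range greaterThan)"
      by (subst borel_Ioi) simp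
    also have "\<dots> = sigma_sets UNIV (range atMost)"
    proof (rule sigma_sets_eqI)
      fix A :: "ennreal set" assume "A \<in> range greaterThan"
      then obtain a where "A = {a<..}" by auto
      then have "A = UNIV - {..a}" by auto
      then show "A \<in> sigma_sets UNIV (range atMost)" by (auto intro: sigma_sets.intros)
    next
      fix A :: "ennreal set" assume "A \<in> range atMost"
      then obtain a where "A = {..a}" by auto
      then have "A = UNIV - {a<..}" by auto
      then show "A \<in> sigma_sets UNIV (range greaterThan)" by (auto intro: sigma_sets.intros)
    qed
    finally show ?thesis .
  qed
  have eq: "emeasure (distr M borel Y) {..a} = emeasure (distr N borel Z) {..a}" for a
  proof (cases a)
    case (real r)
    have "measure M {\<omega>\<in>space M. Y \<omega> \<le> a} = 1 - measure M {\<omega>\<in>space M. a < Y \<omega>}"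
      using assms(3) by (subst M.prob_neg[symmetric]) (auto simp: not_less)
    moreover have "measure N {\<omega>\<in>space N. Z \<omega> \<le> a} = 1 - measure N {\<omega>\<in>space N. a < Z \<omega>}"
      using assms(4) by (subst N.prob_neg[symmetric]) (auto simp: not_less)
    ultimately have "measure M {\<omega>\<in>space M. Y \<omega> \<le> a} = measure N {\<omega>\<in>space N. Z \<omega> \<le> a}"
      using tail[of r] real by simp
    then show ?thesis using assms(3,4)
      by (simp add: emeasure_distr vimage_def Int_def conj_commute M.emeasure_eq_measure N.emeasure_eq_measure)
  next
    case top
    then have "{..a} = UNIV" by (auto simp: top_unique)
    then show ?thesis using DM.emeasure_space_1 DN.emeasure_space_1 by simp
  qed
  show ?thesis
  proof (rule measure_eqI_generator_eq[of "range atMost" UNIV _ _ "\<lambda>_. {..top}"])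
    show "Int_stable (range (atMost :: ennreal \<Rightarrow> _))"
      by (auto simp: Int_stable_def)
    show "(\<Union>i::nat. {..top::ennreal}) = UNIV" by auto
  qed (use eq borel DM.emeasure_finite in auto)
qed

lemma measurable_time_integral:
  fixes g :: "real \<Rightarrow> 'a \<Rightarrow> real"
  assumes meas: "\<And>t. t \<ge> 0 \<Longrightarrow> g t \<in> borel_measurable M"
    and rc: "\<And>t \<omega>. t \<ge> 0 \<Longrightarrow> \<omega> \<in> space M \<Longrightarrow> ((\<lambda>s. g s \<omega>) \<longlongrightarrow> g t \<omega>) (at_right t)"
  shows "(\<lambda>\<omega>. \<integral>\<^sup>+t\<in>{0..}. ennreal (g t \<omega>) \<partial>lborel) \<in> borel_measurable M"
proof -
  have "(\<lambda>x. g (max 0 (fst x)) (snd x)) \<in> borel_measurable (lborel \<Otimes>\<^sub>M M)"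
    using right_continuous_joint_measurable[OF meas rc] by (simp add: case_prod_beta)
  then have "(\<lambda>x. (\<lambda>x. g (max 0 (fst x)) (snd x)) (snd x, fst x)) \<in> borel_measurable (M \<Otimes>\<^sub>M lborel)"
    by (rule measurable_compose[rotated]) measurable
  then have [measurable]: "(\<lambda>x. g (max 0 (snd x)) (fst x)) \<in> borel_measurable (M \<Otimes>\<^sub>M lborel)"
    by simp
  have "(\<lambda>\<omega>. \<integral>\<^sup>+t. ennreal (g (max 0 t) \<omega>) * indicator {0..} t \<partial>lborel) \<in> borel_measurable M"
    by (rule lborel.borel_measurable_nn_integral) (simp add: case_prod_beta)
  also have "(\<lambda>\<omega>. \<integral>\<^sup>+t. ennreal (g (max 0 t) \<omega>) * indicator {0..} t \<partial>lborel) = (\<lambda>\<omega>. \<integral>\<^sup>+t\<in>{0..}. ennreal (g t \<omega>) \<partial>lborel)"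
    by (intro ext nn_integral_cong) (simp add: indicator_def)
  finally show ?thesis .
qed

lemma borel_measurable_right_continuous:
  fixes f :: "real \<Rightarrow> real"
  assumes "\<And>t. t \<ge> 0 \<Longrightarrow> (f \<longlongrightarrow> f t) (at_right t)"
  shows "(\<lambda>t. f (max 0 t)) \<in> borel_measurable borel"
proof -
  have "(\<lambda>(t, \<omega>::unit). f (max 0 t)) \<in> borel_measurable (lborel \<Otimes>\<^sub>M count_space UNIV)"
    by (rule right_continuous_joint_measurable) (use assms in auto)
  then have "(\<lambda>t. (\<lambda>(t, \<omega>::unit). f (max 0 t)) (t, ())) \<in> borel_measurable lborel"
    by (rule measurable_compose[rotated]) simp
  then show ?thesis by simp
qed

lemma (in prob_space) time_integral_prob:
  fixes P :: "real \<Rightarrow> 'a \<Rightarrow> bool"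
  assumes rc: "\<And>t \<omega>. t \<ge> 0 \<Longrightarrow> \<omega> \<in> space M \<Longrightarrow> \<forall>\<^sub>F s in at_right t. P s \<omega> = P t \<omega>"
    and ev: "\<And>t. t \<ge> 0 \<Longrightarrow> {\<omega>\<in>space M. P t \<omega>} \<in> events"
  shows "(\<lambda>\<omega>. \<integral>\<^sup>+t\<in>{0..}. ennreal (of_bool (P t \<omega>)) \<partial>lborel) \<in> borel_measurable M"
    and "(\<integral>\<^sup>+\<omega>. (\<integral>\<^sup>+t\<in>{0..}. ennreal (of_bool (P t \<omega>)) \<partial>lborel) \<partial>M) = (\<integral>\<^sup>+t\<in>{0..}. ennreal (prob {\<omega>\<in>space M. P t \<omega>}) \<partial>lborel)"
proof -
  have meas: "(\<lambda>\<omega>. of_bool (P t \<omega>) :: real) \<in> borel_measurable M" if "t \<ge> 0" for t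
    unfolding of_bool_def using ev[OF that] by (intro measurable_If) auto
  have rc': "((\<lambda>s. of_bool (P s \<omega>) :: real) \<longlongrightarrow> of_bool (P t \<omega>)) (at_right t)" if "t \<ge> 0" "\<omega> \<in> space M" for t \<omega>
    by (rule tendsto_eventually) (use rc[OF that] in \<open>auto elim: eventually_mono\<close>)
  show "(\<lambda>\<omega>. \<integral>\<^sup>+t\<in>{0..}. ennreal (of_bool (P t \<omega>)) \<partial>lborel) \<in> borel_measurable M"
    by (rule measurable_time_integral[of "\<lambda>t \<omega>. of_bool (P t \<omega>)", OF meas rc'])
  have "(\<integral>\<^sup>+\<omega>. (\<integral>\<^sup>+t\<in>{0..}. ennreal (of_bool (P t \<omega>)) \<partial>lborel) \<partial>M) = (\<integral>\<^sup>+t\<in>{0..}. (\<integral>\<^sup>+\<omega>. ennreal (of_bool (P t \<omega>)) \<partial>M) \<partial>lborel)"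
    by (rule nn_integral_time_swap[of M "\<lambda>t \<omega>. of_bool (P t \<omega>)", OF sigma_finite_measure_axioms meas rc'])
  also have "\<dots> = (\<integral>\<^sup>+t\<in>{0..}. ennreal (prob {\<omega>\<in>space M. P t \<omega>}) \<partial>lborel)"
  proof (intro nn_integral_cong)
    fix t :: real
    have "(\<integral>\<^sup>+\<omega>. ennreal (of_bool (P t \<omega>)) \<partial>M) = ennreal (prob {\<omega>\<in>space M. P t \<omega>})" if "t \<ge> 0"
    proof -
      have "(\<integral>\<^sup>+\<omega>. ennreal (of_bool (P t \<omega>)) \<partial>M) = (\<integral>\<^sup>+\<omega>. indicator {\<omega>\<in>space M. P t \<omega>} \<omega> \<partial>M)"
        by (intro nn_integral_cong) (auto simp: indicator_def)
      then show ?thesis using ev[OF that] by (simp add: emeasure_eq_measure)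
    qed
    then show "(\<integral>\<^sup>+\<omega>. ennreal (of_bool (P t \<omega>)) \<partial>M) * indicator {0..} t = ennreal (prob {\<omega>\<in>space M. P t \<omega>}) * indicator {0..} t"
      by (simp add: indicator_def)
  qed
  finally show "(\<integral>\<^sup>+\<omega>. (\<integral>\<^sup>+t\<in>{0..}. ennreal (of_bool (P t \<omega>)) \<partial>lborel) \<partial>M) = (\<integral>\<^sup>+t\<in>{0..}. ennreal (prob {\<omega>\<in>space M. P t \<omega>}) \<partial>lborel)" .
qed

lemma indep_elements_compose:
  assumes "prob_space M" "indep_elements M A X B Y" "f \<in> measurable A A'" "g \<in> measurable B B'"
  shows "indep_elements M A' (\<lambda>\<omega>. f (X \<omega>)) B' (\<lambda>\<omega>. g (Y \<omega>))"
proof -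
  interpret prob_space M by fact
  have X: "X \<in> measurable M A" and Y: "Y \<in> measurable M B"
    and ind: "indep_set (sets (vimage_algebra (space M) X A)) (sets (vimage_algebra (space M) Y B))"
    using assms(2) by (auto simp: indep_elements_def)
  have sub: "sets (vimage_algebra (space M) (\<lambda>\<omega>. h (Z \<omega>)) C') \<subseteq> sets (vimage_algebra (space M) Z C)"
    if Z: "Z \<in> measurable M C" and h: "h \<in> measurable C C'" for Z h and C :: "'z measure" and C' :: "'y measure"
  proof
    fix D assume "D \<in> sets (vimage_algebra (space M) (\<lambda>\<omega>. h (Z \<omega>)) C')"
    then obtain E where E: "E \<in> sets C'" "D = (\<lambda>\<omega>. h (Z \<omega>)) -` E \<inter> space M"
      using measurable_space[OF measurable_compose[OF Z h]] by (auto simp: sets_vimage_algebra2)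
    have D: "D = Z -` (h -` E \<inter> space C) \<inter> space M"
      using measurable_space[OF Z] by (auto simp: E)
    then show "D \<in> sets (vimage_algebra (space M) Z C)"
      unfolding D by (intro in_vimage_algebra measurable_sets[OF h E(1)])
  qed
  have "indep_set (sets (vimage_algebra (space M) (\<lambda>\<omega>. f (X \<omega>)) A')) (sets (vimage_algebra (space M) (\<lambda>\<omega>. g (Y \<omega>)) B'))"
    unfolding indep_set_def
    by (rule indep_sets_mono_sets[OF ind[unfolded indep_set_def]])
      (use sub[OF X assms(3)] sub[OF Y assms(4)] in \<open>auto split: bool.splits\<close>)
  then show ?thesis
    using X Y assms(3,4) by (auto simp: indep_elements_def)
qed

lemma indep_elements_indep_var:
  assumes "prob_space M" "indep_elements M A X B Y"
  shows "prob_space.indep_var M A X B Y"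
proof -
  interpret prob_space M by fact
  show ?thesis
    unfolding indep_var_eq using assms(2) by (simp add: indep_elements_def sets_vimage_algebra)
qed

section \<open>The subordinator\<close>

text \<open>If every label other than a fixed one of \<open>V\<close> leaves independently at rate one, then the right side is
the probability that exactly \<open>V\<close> is left at time \<open>x\<close>, and the left side is inclusion-exclusion over the
labels that stay. Algebraically it is the binomial expansion of
\<open>(1 - exp (- x)) ^ (card A - card V)\<close>.\<close>

lemma sum_supersets_alternating:
  assumes "finite A" "V \<subseteq> A"
  shows "(\<Sum>W\<in>{W. V \<subseteq> W \<and> W \<subseteq> A}. (- 1) ^ card (W - V) * exp (- (real (card W) - 1) * x)) =
    exp (- (real (card V) - 1) * x) * (1 - exp (- x)) ^ (card A - card V)"
proof -
  have fin: "finite V" "finite (A - V)" using assms finite_subset by auto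
  have "(\<Sum>W\<in>{W. V \<subseteq> W \<and> W \<subseteq> A}. (- 1) ^ card (W - V) * exp (- (real (card W) - 1) * x)) =
    (\<Sum>Z\<in>Pow (A - V). exp (- (real (card V) - 1) * x) * (- exp (- x)) ^ card Z)"
  proof (rule sum.reindex_bij_witness[of _ "\<lambda>Z. V \<union> Z" "\<lambda>W. W - V"])
    fix W assume W: "W \<in> {W. V \<subseteq> W \<and> W \<subseteq> A}"
    then have "finite W" using assms finite_subset by auto
    then have "card W = card V + card (W - V)" using W fin
      by (metis (mono_tags, lifting) card_Diff_subset card_mono le_add_diff_inverse mem_Collect_eq)
    then have "exp (- (real (card W) - 1) * x) = exp (- (real (card V) - 1) * x) * exp (- x) ^ card (W - V)"
      by (simp add: exp_add[symmetric] exp_of_nat_mult[symmetric] algebra_simps)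
    then show "exp (- (real (card V) - 1) * x) * (- exp (- x)) ^ card (W - V) =
      (- 1) ^ card (W - V) * exp (- (real (card W) - 1) * x)"
      by (simp add: power_minus[of "exp (- x)"])
  qed (use assms in auto)
  also have "\<dots> = exp (- (real (card V) - 1) * x) * (1 - exp (- x)) ^ card (A - V)"
    using sum_subsets_split[of "A - V" "{}" "- exp (- x)" 1] fin by (simp add: Pow_def flip: sum_distrib_left)
  also have "card (A - V) = card A - card V" using fin assms by (simp add: card_Diff_subset)
  finally show ?thesis .
qed

lemma F_fun_G_fun: "F_fun n x = 1 - G_fun n 1 x"
  by (simp add: F_fun_def G_fun_def)

text \<open>For success probability \<open>exp (- x)\<close>, the number \<open>(n choose j) * exp (- x) * G_fun n j x\<close> is a binomial
probability, and \<open>H_fun n x\<close> is \<open>exp x\<close> times the probability that at least two of \<open>n\<close> trials succeed.\<close>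

lemma H_fun_eq_sum_G_fun:
  assumes "n \<ge> 1"
  shows "H_fun n x = (\<Sum>j=2..n. real (n choose j) * G_fun n j x)"
proof -
  let ?y = "exp (- x)"
  have G: "G_fun n j x = exp x * (?y ^ j * (1 - ?y) ^ (n - j))" for j
  proof -
    have "exp (- (real j - 1) * x) = exp x * ?y ^ j"
      by (simp add: exp_of_nat_mult[symmetric] exp_add[symmetric] algebra_simps)
    then show ?thesis by (simp add: G_fun_def mult_ac)
  qed
  let ?g = "\<lambda>j. real (n choose j) * (?y ^ j * (1 - ?y) ^ (n - j))"
  have "(\<Sum>j\<le>n. ?g j) = 1"
    using binomial_ring[of ?y "1 - ?y" n] by (simp add: mult_ac)
  moreover have "{..n} = {0, 1} \<union> {2..n}" using assms by auto
  ultimately have "sum ?g {2..n} = 1 - (1 - ?y) ^ n - real n * (?y * (1 - ?y) ^ (n - 1))"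
    by (simp add: sum.union_disjoint)
  then have "exp x * sum ?g {2..n} = exp x * (1 - (1 - ?y) ^ n - real n * (?y * (1 - ?y) ^ (n - 1)))"
    by (simp only:)
  also have "\<dots> = exp x * (1 - (1 - ?y) ^ n) - real n * (exp x * ?y) * (1 - ?y) ^ (n - 1)"
    by (simp add: right_diff_distrib mult_ac)
  also have "exp x * ?y = 1" by (simp add: exp_minus)
  finally have "exp x * sum ?g {2..n} = H_fun n x" by (simp add: H_fun_def)
  then show ?thesis by (simp add: G sum_distrib_left mult_ac)
qed

lemma G_fun_bounds: "x \<ge> 0 \<Longrightarrow> j \<ge> 1 \<Longrightarrow> 0 \<le> G_fun n j x \<and> G_fun n j x \<le> 1"
  unfolding G_fun_def by (auto intro!: mult_le_one power_le_one mult_nonpos_nonneg)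

lemma isCont_G_fun: "isCont (G_fun n j) x"
  unfolding G_fun_def by (intro continuous_intros)

lemma borel_measurable_G_fun [measurable]: "G_fun n j \<in> borel_measurable borel"
  unfolding G_fun_def by measurable

locale beta_sub = prob_space N for N :: "'v measure" +
  fixes \<beta> :: real and \<xi> :: "real \<Rightarrow> 'v \<Rightarrow> real"
  assumes sub: "beta_subordinator \<beta> N \<xi>"
begin

lemma \<xi>_measurable: "t \<ge> 0 \<Longrightarrow> \<xi> t \<in> borel_measurable N"
  using sub by (simp add: beta_subordinator_def subordinator_def)

lemma \<xi>_nonneg: "t \<ge> 0 \<Longrightarrow> \<omega> \<in> space N \<Longrightarrow> \<xi> t \<omega> \<ge> 0"
  using sub unfolding beta_subordinator_def subordinator_def mono_on_def
  by (metis atLeast_iff order_refl)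

lemma \<xi>_right_continuous: "t \<ge> 0 \<Longrightarrow> \<omega> \<in> space N \<Longrightarrow> ((\<lambda>t. \<xi> t \<omega>) \<longlongrightarrow> \<xi> t \<omega>) (at_right t)"
  using sub by (simp add: beta_subordinator_def subordinator_def continuous_within)

lemma potential_eq:
  assumes "\<And>x. isCont f x"
  shows "potential N \<xi> f = (\<integral>\<^sup>+t\<in>{0..}. (\<integral>\<^sup>+\<omega>. ennreal (f (\<xi> t \<omega>)) \<partial>N) \<partial>lborel)"
proof -
  have "f \<in> borel_measurable borel"
    using assms by (intro borel_measurable_continuous_onI) (simp add: continuous_at_imp_continuous_on)
  then show ?thesis
    unfolding potential_def
    by (intro nn_integral_time_swap sigma_finite_measure_axioms)
      (auto intro!: measurable_compose[OF \<xi>_measurable] isCont_tendsto_compose[OF assms \<xi>_right_continuous])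
qed

lemma potential_cmult:
  assumes "\<And>x. isCont f x" "c \<ge> 0"
  shows "potential N \<xi> (\<lambda>x. c * f x) = ennreal c * potential N \<xi> f"
proof -
  have rc: "((\<lambda>s. f (\<xi> s \<omega>)) \<longlongrightarrow> f (\<xi> t \<omega>)) (at_right t)" if "t \<ge> 0" "\<omega> \<in> space N" for t \<omega>
    using isCont_tendsto_compose[OF assms(1) \<xi>_right_continuous[OF that]] .
  have fm: "f \<in> borel_measurable borel"
    using assms by (intro borel_measurable_continuous_onI) (simp add: continuous_at_imp_continuous_on)
  have inner: "(\<integral>\<^sup>+t\<in>{0..}. ennreal (c * f (\<xi> t \<omega>)) \<partial>lborel) = ennreal c * (\<integral>\<^sup>+t\<in>{0..}. ennreal (f (\<xi> t \<omega>)) \<partial>lborel)"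
    if \<omega>: "\<omega> \<in> space N" for \<omega>
  proof -
    have [measurable]: "(\<lambda>t. f (\<xi> (max 0 t) \<omega>)) \<in> borel_measurable borel"
      by (rule borel_measurable_right_continuous[of "\<lambda>t. f (\<xi> t \<omega>)"]) (rule rc[OF _ \<omega>])
    have "(\<integral>\<^sup>+t\<in>{0..}. ennreal (c * f (\<xi> t \<omega>)) \<partial>lborel) = (\<integral>\<^sup>+t. ennreal c * (ennreal (f (\<xi> (max 0 t) \<omega>)) * indicator {0..} t) \<partial>lborel)"
      using assms(2) by (intro nn_integral_cong) (simp add: indicator_def ennreal_mult')
    also have "\<dots> = ennreal c * (\<integral>\<^sup>+t. ennreal (f (\<xi> (max 0 t) \<omega>)) * indicator {0..} t \<partial>lborel)"
      by (rule nn_integral_cmult) measurable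
    also have "(\<integral>\<^sup>+t. ennreal (f (\<xi> (max 0 t) \<omega>)) * indicator {0..} t \<partial>lborel) = (\<integral>\<^sup>+t\<in>{0..}. ennreal (f (\<xi> t \<omega>)) \<partial>lborel)"
      by (intro nn_integral_cong) (simp add: indicator_def)
    finally show ?thesis .
  qed
  have "potential N \<xi> (\<lambda>x. c * f x) = (\<integral>\<^sup>+\<omega>. ennreal c * (\<integral>\<^sup>+t\<in>{0..}. ennreal (f (\<xi> t \<omega>)) \<partial>lborel) \<partial>N)"
    unfolding potential_def by (intro nn_integral_cong inner)
  also have "\<dots> = ennreal c * potential N \<xi> f"
    unfolding potential_def
    by (intro nn_integral_cmult measurable_time_integral rc measurable_compose[OF \<xi>_measurable fm])
  finally show ?thesis .
qed

lemma Laplace_\<xi>: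
  assumes "t \<ge> 0"
  shows "(LINT \<omega>|N. exp (- real k * \<xi> t \<omega>)) = exp (- t * phi \<beta> (real k))"
proof -
  have "(LINT \<omega>|N. exp (- complex_of_real (real k) * of_real (\<xi> t \<omega>))) = exp (- of_real t * phi \<beta> (complex_of_real (real k)))"
    using sub assms by (auto simp: beta_subordinator_def)
  then have "complex_of_real (LINT \<omega>|N. exp (- real k * \<xi> t \<omega>)) = complex_of_real (exp (- t * phi \<beta> (real k)))"
    unfolding phi_complex_of_nat
    by (simp add: exp_of_real[symmetric] del: of_real_of_nat_eq flip: integral_complex_of_real)
  then show ?thesis by (simp only: of_real_eq_iff)
qed

lemma integrable_exp_\<xi>: "t \<ge> 0 \<Longrightarrow> integrable N (\<lambda>\<omega>. exp (- real k * \<xi> t \<omega>))"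
  using \<xi>_nonneg \<xi>_measurable by (intro integrable_const_bound[where B = 1]) auto

lemma integrable_G_\<xi>: "t \<ge> 0 \<Longrightarrow> j \<ge> 1 \<Longrightarrow> integrable N (\<lambda>\<omega>. G_fun n j (\<xi> t \<omega>))"
  using \<xi>_nonneg G_fun_bounds[of "\<xi> t _" j n] \<xi>_measurable
  by (intro integrable_const_bound[where B = 1]) auto

lemma nn_integral_G_\<xi>:
  assumes "t \<ge> 0" "j \<ge> 1"
  shows "(\<integral>\<^sup>+\<omega>. ennreal (G_fun n j (\<xi> t \<omega>)) \<partial>N) = ennreal (LINT \<omega>|N. G_fun n j (\<xi> t \<omega>))"
  using integrable_G_\<xi>[OF assms] G_fun_bounds[OF \<xi>_nonneg[OF assms(1)] assms(2)]
  by (intro nn_integral_eq_integral) auto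

lemma expectation_G_\<xi>:
  assumes "t \<ge> 0" "finite A" "V \<subseteq> A" "V \<noteq> {}"
  shows "(LINT \<omega>|N. G_fun (card A) (card V) (\<xi> t \<omega>)) =
    (\<Sum>W\<in>{W. V \<subseteq> W \<and> W \<subseteq> A}. (- 1) ^ card (W - V) * exp (- t * phi \<beta> (real (card W) - 1)))"
proof -
  let ?K = "{W. V \<subseteq> W \<and> W \<subseteq> A}"
  have W: "real (card W) - 1 = real (card W - 1)" if "W \<in> ?K" for W
  proof -
    have "finite W" "W \<noteq> {}" using that assms finite_subset by auto
    then have "card W \<ge> 1" by (simp add: Suc_le_eq card_gt_0_iff)
    then show ?thesis by (simp add: of_nat_diff)
  qed
  have "(LINT \<omega>|N. G_fun (card A) (card V) (\<xi> t \<omega>)) =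
    (LINT \<omega>|N. (\<Sum>W\<in>?K. (- 1) ^ card (W - V) * exp (- real (card W - 1) * \<xi> t \<omega>)))"
    unfolding G_fun_def sum_supersets_alternating[OF assms(2,3), symmetric]
    by (intro Bochner_Integration.integral_cong sum.cong refl) (simp add: W)
  also have "\<dots> = (\<Sum>W\<in>?K. (- 1) ^ card (W - V) * (LINT \<omega>|N. exp (- real (card W - 1) * \<xi> t \<omega>)))"
    using integrable_exp_\<xi>[OF assms(1)] by (subst Bochner_Integration.integral_sum) auto
  also have "\<dots> = (\<Sum>W\<in>?K. (- 1) ^ card (W - V) * exp (- t * phi \<beta> (real (card W) - 1)))"
    using Laplace_\<xi>[OF assms(1)] by (intro sum.cong) (auto simp: W)
  finally show ?thesis .
qed

text \<open>If \<open>\<xi> t < x\<close>, right-continuity keeps \<open>\<xi>\<close> below \<open>x\<close> on some \<open>[t, c)\<close>, so the level is not reached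
before \<open>c\<close>. This holds for every path, hence passage times over a random level are measurable.\<close>

lemma less_passage_time_iff:
  assumes "t \<ge> 0" "\<omega> \<in> space N"
  shows "ennreal t < passage_time (\<lambda>t. \<xi> t \<omega>) x \<longleftrightarrow> \<xi> t \<omega> < x"
proof
  assume "ennreal t < passage_time (\<lambda>t. \<xi> t \<omega>) x"
  then show "\<xi> t \<omega> < x" unfolding passage_time_def
    using assms(1) by (metis (mono_tags, lifting) INF_lower leD linorder_not_le mem_Collect_eq)
next
  assume "\<xi> t \<omega> < x"
  then have "\<forall>\<^sub>F s in at_right t. \<xi> s \<omega> < x"
    using \<xi>_right_continuous[OF assms] by (rule order_tendstoD(2)[rotated])
  then obtain c where c: "c > t" "\<And>s. t < s \<Longrightarrow> s < c \<Longrightarrow> \<xi> s \<omega> < x"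
    by (auto simp: eventually_at_right_field)
  have mono: "\<xi> r \<omega> \<le> \<xi> s \<omega>" if "0 \<le> r" "r \<le> s" for r s
    using sub that assms(2) by (auto simp: beta_subordinator_def subordinator_def mono_on_def)
  have "ennreal c \<le> passage_time (\<lambda>t. \<xi> t \<omega>) x"
    unfolding passage_time_def
  proof (rule INF_greatest)
    fix s assume s: "s \<in> {t. 0 \<le> t \<and> x \<le> \<xi> t \<omega>}"
    have "c \<le> s"
    proof (rule ccontr)
      assume "\<not> c \<le> s"
      then have "\<xi> s \<omega> \<le> \<xi> ((max s t + c) / 2) \<omega>" using s c(1) by (intro mono) (auto simp: max_def)
      moreover have "\<xi> ((max s t + c) / 2) \<omega> < x" using c \<open>\<not> c \<le> s\<close> by (intro c(2)) (auto simp: max_def)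
      ultimately show False using s by simp
    qed
    then show "ennreal c \<le> ennreal s" by (rule ennreal_leI)
  qed
  then show "ennreal t < passage_time (\<lambda>t. \<xi> t \<omega>) x"
    using c(1) assms(1) by (metis ennreal_lessI less_le_trans order_le_less_trans)
qed

lemma passage_time_measurable:
  assumes [measurable]: "Y \<in> borel_measurable N"
  shows "(\<lambda>\<omega>. passage_time (\<lambda>t. \<xi> t \<omega>) (Y \<omega>)) \<in> borel_measurable N"
proof (rule borel_measurableI_greater)
  fix y :: ennreal
  show "{\<omega>\<in>space N. y < passage_time (\<lambda>t. \<xi> t \<omega>) (Y \<omega>)} \<in> events"
  proof (cases y)
    case (real r)
    have [measurable]: "\<xi> r \<in> borel_measurable N" by (rule \<xi>_measurable) fact
    have "{\<omega>\<in>space N. y < passage_time (\<lambda>t. \<xi> t \<omega>) (Y \<omega>)} = {\<omega>\<in>space N. \<xi> r \<omega> < Y \<omega>}"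
      using real less_passage_time_iff by auto
    also have "\<dots> \<in> events" by measurable
    finally show ?thesis .
  qed simp
qed

text \<open>\<open>F_fun n\<close> is the tail function of the maximum on \<open>[0, \<infinity>)\<close>, and by independence it may be evaluated
at \<open>\<xi> t\<close> under the integral over the law of \<open>\<xi> t\<close>.\<close>

lemma prob_less_Max_exponential:
  assumes n: "n \<ge> 2" and t: "t \<ge> 0"
    and E: "\<And>i. i \<in> {1..n-1} \<Longrightarrow> distributed N lborel (E i) (\<lambda>x. ennreal (exponential_density 1 x))"
    and indep: "indep_vars (\<lambda>_. borel) E {1..n-1}"
    and ind: "indep_elements N borel (\<lambda>\<omega>. Max ((\<lambda>i. E i \<omega>) ` {1..n-1}))
          (\<Pi>\<^sub>M t\<in>{0..}. borel) (\<lambda>\<omega>. \<lambda>t\<in>{0..}. \<xi> t \<omega>)"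
  shows "prob {\<omega>\<in>space N. \<xi> t \<omega> < Max ((\<lambda>i. E i \<omega>) ` {1..n-1})} = (LINT \<omega>|N. F_fun n (\<xi> t \<omega>))"
proof -
  define Y where "Y \<omega> = Max ((\<lambda>i. E i \<omega>) ` {1..n-1})" for \<omega>
  have ne: "{1..n-1} \<noteq> {}" using n by auto
  have "indep_elements N borel Y borel (\<lambda>\<omega>. (\<lambda>t\<in>{0..}. \<xi> t \<omega>) t)"
    using t unfolding Y_def by (intro indep_elements_compose[OF prob_space_axioms ind]) auto
  then have iv: "indep_var borel Y borel (\<xi> t)"
    using t by (intro indep_elements_indep_var prob_space_axioms) simp
  have Ym: "Y \<in> borel_measurable N" using iv by (rule indep_var_rv1)
  have cdf: "prob {\<omega>\<in>space N. Y \<omega> \<le> x} = (1 - exp (- x)) ^ (n - 1)" if x: "x \<ge> 0" for x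
  proof -
    have "{\<omega>\<in>space N. Y \<omega> \<le> x} = (\<Inter>i\<in>{1..n-1}. E i -` {..x} \<inter> space N)"
      using ne by (auto simp: Y_def)
    also have "prob \<dots> = (\<Prod>i\<in>{1..n-1}. prob (E i -` {..x} \<inter> space N))"
      by (rule indep_varsD_finite[OF indep ne]) auto
    also have "\<dots> = (\<Prod>i\<in>{1..n-1}. 1 - exp (- x))"
    proof (intro prod.cong refl)
      fix i assume i: "i \<in> {1..n-1}"
      have "prob (E i -` {..x} \<inter> space N) = prob {\<omega>\<in>space N. E i \<omega> \<le> x}"
        by (intro arg_cong[where f = prob]) auto
      then show "prob (E i -` {..x} \<inter> space N) = 1 - exp (- x)"
        using exponential_distributedD_le[OF E[OF i] x] by simp
    qed
    finally show ?thesis by simp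
  qed
  have F: "emeasure (distr N borel Y) {y. x < y} = ennreal (F_fun n x)" if x: "x \<ge> 0" for x
  proof -
    have "emeasure (distr N borel Y) {y. x < y} = prob {\<omega>\<in>space N. \<not> Y \<omega> \<le> x}"
      using Ym by (subst emeasure_distr) (auto simp: emeasure_eq_measure not_le intro!: arg_cong[where f = prob])
    also have "\<dots> = 1 - prob {\<omega>\<in>space N. Y \<omega> \<le> x}"
      using Ym by (subst prob_neg) auto
    finally show ?thesis using cdf[OF x] by (simp add: F_fun_def)
  qed
  interpret DY: prob_space "distr N borel Y" using Ym by (rule prob_space_distr)
  interpret DX: prob_space "distr N borel (\<xi> t)" using \<xi>_measurable[OF t] by (rule prob_space_distr)
  interpret P: pair_sigma_finite "distr N borel Y" "distr N borel (\<xi> t)" ..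
  have pm: "distr N borel Y \<Otimes>\<^sub>M distr N borel (\<xi> t) = distr N (borel \<Otimes>\<^sub>M borel) (\<lambda>\<omega>. (Y \<omega>, \<xi> t \<omega>))"
    using iv by (simp add: indep_var_distribution_eq)
  let ?D = "{p::real\<times>real. snd p < fst p}"
  have D: "?D \<in> sets (borel \<Otimes>\<^sub>M borel)"
  proof -
    have "Measurable.pred (borel \<Otimes>\<^sub>M borel) (\<lambda>p::real\<times>real. snd p < fst p)" by measurable
    then show ?thesis by (simp add: pred_def space_pair_measure)
  qed
  have "ennreal (prob {\<omega>\<in>space N. \<xi> t \<omega> < Y \<omega>}) = emeasure (distr N (borel \<Otimes>\<^sub>M borel) (\<lambda>\<omega>. (Y \<omega>, \<xi> t \<omega>))) ?D"
    using Ym \<xi>_measurable[OF t] D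
    by (subst emeasure_distr) (auto simp: emeasure_eq_measure intro!: arg_cong[where f = prob])
  also have "\<dots> = (\<integral>\<^sup>+x. emeasure (distr N borel Y) ((\<lambda>y. (y, x)) -` ?D) \<partial>distr N borel (\<xi> t))"
    unfolding pm[symmetric] by (rule P.emeasure_pair_measure_alt2) (use D in simp)
  also have "\<dots> = (\<integral>\<^sup>+\<omega>. emeasure (distr N borel Y) {y. \<xi> t \<omega> < y} \<partial>N)"
    using \<xi>_measurable[OF t] P.measurable_emeasure_Pair2[of ?D] D by (subst nn_integral_distr) (auto simp: vimage_def)
  also have "\<dots> = (\<integral>\<^sup>+\<omega>. ennreal (F_fun n (\<xi> t \<omega>)) \<partial>N)"
    using \<xi>_nonneg[OF t] by (intro nn_integral_cong F) auto
  also have "\<dots> = ennreal (LINT \<omega>|N. F_fun n (\<xi> t \<omega>))"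
    using integrable_G_\<xi>[OF t, of 1 n] G_fun_bounds[OF \<xi>_nonneg[OF t], of _ 1 n]
    by (intro nn_integral_eq_integral) (auto simp: F_fun_G_fun)
  finally have "ennreal (prob {\<omega>\<in>space N. \<xi> t \<omega> < Y \<omega>}) = ennreal (LINT \<omega>|N. F_fun n (\<xi> t \<omega>))" .
  moreover have "0 \<le> (LINT \<omega>|N. F_fun n (\<xi> t \<omega>))"
    using G_fun_bounds[OF \<xi>_nonneg[OF t], of _ 1 n] by (intro integral_nonneg_AE) (auto simp: F_fun_G_fun)
  ultimately show ?thesis by (simp add: Y_def)
qed

end

section \<open>The block of a uniformly chosen leaf\<close>

lemma measure_eq_AE':
  assumes "AE \<omega> in M. P \<omega> \<longleftrightarrow> Q \<omega>" "{\<omega>\<in>space M. P \<omega>} \<in> sets M" "{\<omega>\<in>space M. Q \<omega>} \<in> sets M"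
  shows "measure M {\<omega>\<in>space M. P \<omega>} = measure M {\<omega>\<in>space M. Q \<omega>}"
  using assms by (intro measure_eq_AE) auto

text \<open>The possible pairs of a block of size \<open>j\<close> and a leaf in it.\<close>

lemma card_pointed_subsets:
  "card (Sigma {V. V \<subseteq> {1..n::nat} \<and> card V = j} (\<lambda>V. V)) = j * (n choose j)"
proof -
  have "card (Sigma {V. V \<subseteq> {1..n::nat} \<and> card V = j} (\<lambda>V. V)) = (\<Sum>V\<in>{V. V \<subseteq> {1..n} \<and> card V = j}. card V)"
    by (rule card_SigmaI) (auto intro: finite_subset)
  also have "\<dots> = (\<Sum>V\<in>{V. V \<subseteq> {1..n::nat} \<and> card V = j}. j)" by (intro sum.cong) auto
  also have "\<dots> = j * (n choose j)" using n_subsets[of "{1..n}" j] by simp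
  finally show ?thesis .
qed

locale beta_tree_leaf = beta_tree M \<beta> n X for M :: "'w measure" and \<beta> n X +
  fixes U :: "'w \<Rightarrow> nat"
  assumes leaf: "uniform_leaf n M X U"
begin

lemma U_measurable: "U \<in> measurable M (count_space UNIV)"
  using leaf by (simp add: uniform_leaf_def indep_elements_def)

lemma U_pred: "{\<omega>\<in>space M. P (U \<omega>)} \<in> events"
proof -
  have "U -` {x. P x} \<inter> space M \<in> events" by (rule measurable_sets[OF U_measurable]) simp
  then show ?thesis by (simp add: vimage_def Int_def conj_commute)
qed

lemma prob_U: assumes "u \<in> {1..n}" shows "prob {\<omega>\<in>space M. U \<omega> = u} = 1 / real n"
proof -
  have "prob (U -` {u} \<inter> space M) = measure (distr M (count_space UNIV) U) {u}"
    using U_measurable by (subst measure_distr) auto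
  also have "\<dots> = 1 / real n"
    using leaf assms n by (simp add: uniform_leaf_def measure_pmf_single pmf_of_set)
  also have "U -` {u} \<inter> space M = {\<omega>\<in>space M. U \<omega> = u}" by auto
  finally show ?thesis .
qed

lemma AE_U: "AE \<omega> in M. U \<omega> \<in> {1..n}"
proof -
  have "prob {\<omega>\<in>space M. U \<omega> \<in> {1..n} \<and> True} = (\<Sum>u\<in>{1..n}. prob {\<omega>\<in>space M. U \<omega> = u})"
  proof -
    have "{\<omega>\<in>space M. U \<omega> \<in> {1..n} \<and> True} = (\<Union>u\<in>{1..n}. {\<omega>\<in>space M. U \<omega> = u})" by auto
    then show ?thesis
      using U_pred by (simp only:) (intro finite_measure_finite_Union, auto simp: disjoint_family_on_def)
  qed
  also have "\<dots> = 1" using prob_U n by simp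
  finally show ?thesis using U_pred[of "\<lambda>u. u \<in> {1..n}"] by (subst (asm) prob_Collect_eq_1) auto
qed

lemma prob_leaf_independent:
  assumes "u \<in> {1..n}" "s \<ge> 0" "t \<ge> 0"
  shows "prob {\<omega>\<in>space M. U \<omega> = u \<and> P (X s \<omega>) \<and> R (X t \<omega>)} = prob {\<omega>\<in>space M. P (X s \<omega>) \<and> R (X t \<omega>)} / real n"
proof -
  let ?C = "\<Pi>\<^sub>M t\<in>{0::real..}. count_space (label_partitions n)"
  let ?Y = "\<lambda>\<omega>. \<lambda>t\<in>{0..}. X t \<omega>"
  have ind: "indep_set (sets (vimage_algebra (space M) U (count_space UNIV))) (sets (vimage_algebra (space M) ?Y ?C))"
    and Y: "?Y \<in> measurable M ?C"
    using leaf by (auto simp: uniform_leaf_def indep_elements_def)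
  have comp: "{q\<in>space ?C. P' (q r)} \<in> sets ?C" if "r \<ge> 0" for r P'
  proof -
    have "(\<lambda>q. q r) -` {x\<in>label_partitions n. P' x} \<inter> space ?C \<in> sets ?C"
      using that by (intro measurable_sets[OF measurable_component_singleton[of r]]) auto
    moreover have "(\<lambda>q. q r) -` {x\<in>label_partitions n. P' x} \<inter> space ?C = {q\<in>space ?C. P' (q r)}"
      using that by (auto simp: space_PiM dest: PiE_mem)
    ultimately show ?thesis by simp
  qed
  have "?Y -` ({q\<in>space ?C. P (q s)} \<inter> {q\<in>space ?C. R (q t)}) \<inter> space M \<in> sets (vimage_algebra (space M) ?Y ?C)"
    using assms by (intro in_vimage_algebra sets.Int comp)
  moreover have "?Y -` ({q\<in>space ?C. P (q s)} \<inter> {q\<in>space ?C. R (q t)}) \<inter> space M = {\<omega>\<in>space M. P (X s \<omega>) \<and> R (X t \<omega>)}"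
    using measurable_space[OF Y] assms by auto
  moreover have "U -` {u} \<inter> space M \<in> sets (vimage_algebra (space M) U (count_space UNIV))"
    by (intro in_vimage_algebra) simp
  ultimately have "prob ((U -` {u} \<inter> space M) \<inter> {\<omega>\<in>space M. P (X s \<omega>) \<and> R (X t \<omega>)}) =
    prob (U -` {u} \<inter> space M) * prob {\<omega>\<in>space M. P (X s \<omega>) \<and> R (X t \<omega>)}"
    using indep_setD[OF ind] by simp
  moreover have "(U -` {u} \<inter> space M) \<inter> {\<omega>\<in>space M. P (X s \<omega>) \<and> R (X t \<omega>)} = {\<omega>\<in>space M. U \<omega> = u \<and> P (X s \<omega>) \<and> R (X t \<omega>)}"
    by auto
  moreover have "U -` {u} \<inter> space M = {\<omega>\<in>space M. U \<omega> = u}" by auto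
  ultimately show ?thesis using prob_U[OF assms(1)] by simp
qed

lemma UX_pred:
  assumes "s \<ge> 0" "t \<ge> 0"
  shows "{\<omega>\<in>space M. P (U \<omega>) (X s \<omega>) (X t \<omega>)} \<in> events"
proof -
  have "{\<omega>\<in>space M. P (U \<omega>) (X s \<omega>) (X t \<omega>)} =
    (\<Union>u. \<Union>x\<in>label_partitions n. {\<omega>\<in>space M. U \<omega> = u} \<inter> {\<omega>\<in>space M. X s \<omega> = x \<and> P u x (X t \<omega>)})"
    using X_in[OF assms(1)] by auto
  moreover have "\<dots> \<in> events"
  proof -
    have "(\<Union>x\<in>label_partitions n. {\<omega>\<in>space M. U \<omega> = u} \<inter> {\<omega>\<in>space M. X s \<omega> = x \<and> P u x (X t \<omega>)}) \<in> events" for u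
      by (intro sets.finite_UN finite_label_partitions sets.Int U_pred X_pred_conj assms)
    then show ?thesis by (rule sets.countable_nat_UN[OF image_subsetI])
  qed
  ultimately show ?thesis by simp
qed

abbreviation B :: "real \<Rightarrow> 'w \<Rightarrow> nat set" where "B t \<omega> \<equiv> block_of (X t \<omega>) (U \<omega>)"

lemma AE_refining: "AE \<omega> in M. refining n (\<lambda>t. X t \<omega>) (U \<omega>)"
  using AE_refining_path AE_U by eventually_elim (simp add: refining_def)

lemma B_right_continuous: "t \<ge> 0 \<Longrightarrow> \<omega> \<in> space M \<Longrightarrow> \<forall>\<^sub>F s in at_right t. B s \<omega> = B t \<omega>"
  using X_right_continuous[of t \<omega>] by (auto elim: eventually_mono)

end

lemma LIMSEQ_exit_rate:
  fixes c :: real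
  shows "(\<lambda>m. real (Suc m) * (1 - exp (- (1 / real (Suc m)) * c))) \<longlonglongrightarrow> c"
proof -
  have "((\<lambda>x. 1 - exp (- x * c)) has_real_derivative c) (at 0)"
    by (auto intro!: derivative_eq_intros)
  then have "((\<lambda>h. (1 - exp (- h * c)) / h) \<longlongrightarrow> c) (at 0)"
    by (simp add: has_field_derivative_iff)
  moreover have "filterlim (\<lambda>m. 1 / real (Suc m)) (at 0) sequentially"
    using LIMSEQ_inverse_real_of_nat by (intro filterlim_atI) (auto simp: inverse_eq_divide)
  ultimately have "(\<lambda>m. (1 - exp (- (1 / real (Suc m)) * c)) / (1 / real (Suc m))) \<longlonglongrightarrow> c"
    by (rule filterlim_compose)
  then show ?thesis by (simp add: mult.commute)
qed

locale beta_tree_sub = beta_tree_leaf M \<beta> n X U + S: beta_sub N \<beta> \<xi>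
  for M :: "'w measure" and \<beta> n X U and N :: "'v measure" and \<xi>
begin

lemma prob_block_G:
  assumes "t \<ge> 0" "V \<subseteq> {1..n}" "V \<noteq> {}"
  shows "prob {\<omega>\<in>space M. V \<in> X t \<omega>} = (LINT \<omega>|N. G_fun n (card V) (\<xi> t \<omega>))"
  using prob_block[OF assms] S.expectation_G_\<xi>[of t "{1..n}" V] assms by simp

text \<open>On a refining path the block of the leaf has size \<open>j\<close> at both times exactly if one and the same set \<open>V\<close> is
its block at \<open>s\<close> and is still together at \<open>t\<close>. Summing over the pairs of \<open>V\<close> and a leaf in \<open>V\<close>, each
leaf having probability \<open>1 / n\<close>, produces \<open>j * (n choose j) / n\<close> equal terms.\<close>

lemma prob_leaf_block_size:
  assumes st: "0 \<le> s" "s \<le> t" and j: "j \<in> {1..n}"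
  shows "prob {\<omega>\<in>space M. card (B s \<omega>) = j \<and> card (B t \<omega>) = j} =
    exp (- (t - s) * phi \<beta> (real j - 1)) * (real ((n - 1) choose (j - 1)) * (LINT \<omega>|N. G_fun n j (\<xi> s \<omega>)))"
proof -
  let ?P = "Sigma {V. V \<subseteq> {1..n} \<and> card V = j} (\<lambda>V. V)"
  let ?E = "\<lambda>(V, u). {\<omega>\<in>space M. U \<omega> = u \<and> V \<in> X s \<omega> \<and> together V (X t \<omega>)}"
  have t: "0 \<le> t" using st by simp
  have "AE \<omega> in M. (card (B s \<omega>) = j \<and> card (B t \<omega>) = j) \<longleftrightarrow> (\<exists>(V, u)\<in>?P. U \<omega> = u \<and> V \<in> X s \<omega> \<and> together V (X t \<omega>))"
    using AE_refining
  proof eventually_elim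
    case (elim \<omega>)
    interpret refining n "\<lambda>t. X t \<omega>" "U \<omega>" by fact
    show ?case
    proof
      assume c: "card (B s \<omega>) = j \<and> card (B t \<omega>) = j"
      then have "B t \<omega> = B s \<omega>" using block_eq_of_card_eq[of s t] st by simp
      then have "together (B s \<omega>) (X t \<omega>)" using block_in(1)[OF t] by (auto simp: together_def)
      then show "\<exists>(V, u)\<in>?P. U \<omega> = u \<and> V \<in> X s \<omega> \<and> together V (X t \<omega>)"
        using c block_in[OF st(1)] block_subset[OF st(1)] by (intro bexI[of _ "(B s \<omega>, U \<omega>)"]) auto
    next
      assume "\<exists>(V, u)\<in>?P. U \<omega> = u \<and> V \<in> X s \<omega> \<and> together V (X t \<omega>)"
      then obtain V where V: "V \<subseteq> {1..n}" "card V = j" "U \<omega> \<in> V" "V \<in> X s \<omega>" "together V (X t \<omega>)" by auto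
      have "B s \<omega> = V" using block_eqI[OF st(1) V(4,3)] .
      moreover have "B t \<omega> = V"
        using block_subset_of_together[OF t V(3,5)] block_antimono[OF st] \<open>B s \<omega> = V\<close> by auto
      ultimately show "card (B s \<omega>) = j \<and> card (B t \<omega>) = j" using V(2) by simp
    qed
  qed
  then have "prob {\<omega>\<in>space M. card (B s \<omega>) = j \<and> card (B t \<omega>) = j} =
    prob {\<omega>\<in>space M. \<exists>(V, u)\<in>?P. U \<omega> = u \<and> V \<in> X s \<omega> \<and> together V (X t \<omega>)}"
    by (rule measure_eq_AE') (intro UX_pred[OF st(1) t])+
  also have "{\<omega>\<in>space M. \<exists>(V, u)\<in>?P. U \<omega> = u \<and> V \<in> X s \<omega> \<and> together V (X t \<omega>)} = (\<Union>q\<in>?P. ?E q)"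
    by auto
  also have "prob \<dots> = (\<Sum>q\<in>?P. prob (?E q))"
  proof (rule finite_measure_finite_Union)
    show "finite ?P" by (intro finite_SigmaI) (auto intro: finite_subset)
    show "?E ` ?P \<subseteq> events" using UX_pred[OF st(1) t] by auto
    show "disjoint_family_on ?E ?P"
      unfolding disjoint_family_on_def
    proof (intro ballI impI equals0I)
      fix q r \<omega> assume q: "q \<in> ?P" and r: "r \<in> ?P" and "q \<noteq> r" and \<omega>: "\<omega> \<in> ?E q \<inter> ?E r"
      obtain V u where qV: "q = (V, u)" by (cases q)
      obtain W v where rW: "r = (W, v)" by (cases r)
      have "disjoint (X s \<omega>)" using \<omega> X_in[OF st(1), of \<omega>] by (auto simp: qV label_partitions_def partition_on_def)
      then have "V = W" using \<omega> q r disjointD[of "X s \<omega>" V W] by (auto simp: qV rW)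
      moreover have "u = v" using \<omega> by (auto simp: qV rW)
      ultimately show False using \<open>q \<noteq> r\<close> by (simp add: qV rW)
    qed
  qed
  also have "\<dots> = (\<Sum>q\<in>?P. exp (- (t - s) * phi \<beta> (real j - 1)) * (LINT \<omega>|N. G_fun n j (\<xi> s \<omega>)) / real n)"
  proof (intro sum.cong refl)
    fix q assume "q \<in> ?P"
    then obtain V u where q: "q = (V, u)" "V \<subseteq> {1..n}" "card V = j" "u \<in> V" by auto
    have V: "V \<noteq> {}" "u \<in> {1..n}" using q by auto
    have "prob (?E q) = prob {\<omega>\<in>space M. V \<in> X s \<omega> \<and> together V (X t \<omega>)} / real n"
      unfolding q(1) prod.case by (rule prob_leaf_independent[OF V(2) st(1) t])
    also have "prob {\<omega>\<in>space M. V \<in> X s \<omega> \<and> together V (X t \<omega>)} =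
      exp (- (t - s) * phi \<beta> (real j - 1)) * prob {\<omega>\<in>space M. V \<in> X s \<omega> \<and> together V (X s \<omega>)}"
      unfolding prob_together_Markov[OF st V(1)] q(3) ..
    also have "{\<omega>\<in>space M. V \<in> X s \<omega> \<and> together V (X s \<omega>)} = {\<omega>\<in>space M. V \<in> X s \<omega>}"
      by (auto simp: together_def)
    also have "prob \<dots> = (LINT \<omega>|N. G_fun n j (\<xi> s \<omega>))"
      using prob_block_G[OF st(1) q(2) V(1)] q(3) by simp
    finally show "prob (?E q) = exp (- (t - s) * phi \<beta> (real j - 1)) * (LINT \<omega>|N. G_fun n j (\<xi> s \<omega>)) / real n" .
  qed
  also have "\<dots> = real (card ?P) / real n * (exp (- (t - s) * phi \<beta> (real j - 1)) * (LINT \<omega>|N. G_fun n j (\<xi> s \<omega>)))"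
    by simp
  also have "card ?P = n * ((n - 1) choose (j - 1))"
    using card_pointed_subsets[of n j] times_binomial_minus1_eq[of j n] j by simp
  also have "real (n * ((n - 1) choose (j - 1))) / real n = real ((n - 1) choose (j - 1))" using n by simp
  finally show ?thesis by (simp add: mult_ac)
qed

lemma prob_leaf_not_singleton:
  assumes "t \<ge> 0"
  shows "prob {\<omega>\<in>space M. card (B t \<omega>) \<noteq> 1} = (LINT \<omega>|N. F_fun n (\<xi> t \<omega>))"
proof -
  have "prob {\<omega>\<in>space M. card (B t \<omega>) \<noteq> 1} = 1 - prob {\<omega>\<in>space M. card (B t \<omega>) = 1 \<and> card (B t \<omega>) = 1}"
    using UX_pred[OF assms assms, of "\<lambda>u x y. card (block_of x u) = 1"] by (subst prob_neg[symmetric]) auto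
  also have "\<dots> = 1 - (LINT \<omega>|N. G_fun n 1 (\<xi> t \<omega>))"
    using prob_leaf_block_size[of t t 1] assms n by simp
  also have "\<dots> = (LINT \<omega>|N. F_fun n (\<xi> t \<omega>))"
    using S.integrable_G_\<xi>[OF assms, of 1 n] S.prob_space by (simp add: F_fun_G_fun)
  finally show ?thesis .
qed

text \<open>By right-continuity the infimum may be taken over rational times. This is an identity on all
paths, not only on the refining ones.\<close>

lemma cont_height_measurable: "(\<lambda>\<omega>. cont_height (\<lambda>t. X t \<omega>) (U \<omega>)) \<in> borel_measurable M"
proof -
  let ?Q = "\<rat> \<inter> {0::real..}"
  let ?g = "\<lambda>\<omega>. INF q\<in>?Q. if {U \<omega>} \<in> X q \<omega> then ennreal q else \<top>"
  have "?g \<in> borel_measurable M"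
  proof (rule borel_measurable_INF)
    show "countable ?Q" by (intro countable_Int1 countable_rat)
    fix q assume "q \<in> ?Q"
    then show "(\<lambda>\<omega>. if {U \<omega>} \<in> X q \<omega> then ennreal q else \<top>) \<in> borel_measurable M"
      using UX_pred[of q q "\<lambda>u x y. {u} \<in> x"] by (intro measurable_If) auto
  qed
  moreover have "cont_height (\<lambda>t. X t \<omega>) (U \<omega>) = ?g \<omega>" if \<omega>: "\<omega> \<in> space M" for \<omega>
  proof (rule antisym)
    show "cont_height (\<lambda>t. X t \<omega>) (U \<omega>) \<le> ?g \<omega>"
      unfolding cont_height_def by (rule INF_greatest) (auto intro!: INF_lower)
    show "?g \<omega> \<le> cont_height (\<lambda>t. X t \<omega>) (U \<omega>)"
      unfolding cont_height_def
    proof (rule INF_greatest, rule ennreal_le_epsilon)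
      fix t e :: real assume t: "t \<in> {t. 0 \<le> t \<and> {U \<omega>} \<in> X t \<omega>}" and e: "0 < e"
      obtain q where q: "q \<in> \<rat>" "t < q" "q < t + e" "X q \<omega> = X t \<omega>"
        using rational_right_of[OF X_right_continuous[of t \<omega>], of "t + e"] t \<omega> e by auto
      have "?g \<omega> \<le> (if {U \<omega>} \<in> X q \<omega> then ennreal q else \<top>)"
        using q t by (intro INF_lower) auto
      also have "\<dots> = ennreal q" using q t by simp
      also have "\<dots> \<le> ennreal (t + e)" using q by (intro ennreal_leI) simp
      finally show "?g \<omega> \<le> ennreal t + ennreal e" using t e by simp
    qed
  qed
  ultimately show ?thesis by (simp cong: measurable_cong)
qed

lemma AE_less_cont_height_iff:
  "AE \<omega> in M. \<forall>t\<ge>0. ennreal t < cont_height (\<lambda>s. X s \<omega>) (U \<omega>) \<longleftrightarrow> card (B t \<omega>) \<noteq> 1"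
  using AE_refining by eventually_elim (auto dest: refining.less_cont_height_iff)

section \<open>Heights, clades and total length\<close>

lemma prob_less_cont_height:
  assumes "t \<ge> 0"
  shows "prob {\<omega>\<in>space M. ennreal t < cont_height (\<lambda>s. X s \<omega>) (U \<omega>)} = (LINT \<omega>|N. F_fun n (\<xi> t \<omega>))"
proof -
  have "prob {\<omega>\<in>space M. ennreal t < cont_height (\<lambda>s. X s \<omega>) (U \<omega>)} = prob {\<omega>\<in>space M. card (B t \<omega>) \<noteq> 1}"
  proof (rule measure_eq_AE')
    show "AE \<omega> in M. ennreal t < cont_height (\<lambda>s. X s \<omega>) (U \<omega>) \<longleftrightarrow> card (B t \<omega>) \<noteq> 1"
      using AE_less_cont_height_iff by eventually_elim (use assms in auto)
    show "{\<omega>\<in>space M. ennreal t < cont_height (\<lambda>s. X s \<omega>) (U \<omega>)} \<in> events"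
      using cont_height_measurable by measurable
    show "{\<omega>\<in>space M. card (B t \<omega>) \<noteq> 1} \<in> events" by (rule UX_pred[OF assms assms])
  qed
  then show ?thesis using prob_leaf_not_singleton[OF assms] by simp
qed

lemma expectation_cont_height:
  "(\<integral>\<^sup>+\<omega>. cont_height (\<lambda>t. X t \<omega>) (U \<omega>) \<partial>M) = potential N \<xi> (F_fun n)"
proof -
  have "(\<integral>\<^sup>+\<omega>. cont_height (\<lambda>t. X t \<omega>) (U \<omega>) \<partial>M) = (\<integral>\<^sup>+\<omega>. (\<integral>\<^sup>+t\<in>{0..}. ennreal (of_bool (card (B t \<omega>) \<noteq> 1)) \<partial>lborel) \<partial>M)"
  proof (rule nn_integral_cong_AE)
    show "AE \<omega> in M. cont_height (\<lambda>t. X t \<omega>) (U \<omega>) = (\<integral>\<^sup>+t\<in>{0..}. ennreal (of_bool (card (B t \<omega>) \<noteq> 1)) \<partial>lborel)"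
      using AE_less_cont_height_iff
    proof eventually_elim
      case (elim \<omega>)
      show ?case
        by (subst nn_integral_less_height[of "cont_height (\<lambda>t. X t \<omega>) (U \<omega>)", symmetric], intro nn_integral_cong)
          (use elim in \<open>auto simp: indicator_def\<close>)
    qed
  qed
  also have "\<dots> = (\<integral>\<^sup>+t\<in>{0..}. ennreal (prob {\<omega>\<in>space M. card (B t \<omega>) \<noteq> 1}) \<partial>lborel)"
  proof (rule time_integral_prob)
    fix t :: real and \<omega> assume "t \<ge> 0" "\<omega> \<in> space M"
    from B_right_continuous[OF this] show "\<forall>\<^sub>F s in at_right t. (card (B s \<omega>) \<noteq> 1) = (card (B t \<omega>) \<noteq> 1)"
      by eventually_elim simp
  qed (rule UX_pred)
  also have "\<dots> = potential N \<xi> (F_fun n)"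
  proof -
    have "isCont (F_fun n) x" for x unfolding F_fun_def by (intro continuous_intros)
    then have "potential N \<xi> (F_fun n) = (\<integral>\<^sup>+t\<in>{0..}. (\<integral>\<^sup>+\<omega>. ennreal (F_fun n (\<xi> t \<omega>)) \<partial>N) \<partial>lborel)"
      by (rule S.potential_eq)
    also have "\<dots> = (\<integral>\<^sup>+t\<in>{0..}. ennreal (prob {\<omega>\<in>space M. card (B t \<omega>) \<noteq> 1}) \<partial>lborel)"
    proof (intro nn_integral_cong)
      fix t :: real
      have "(\<integral>\<^sup>+\<omega>. ennreal (F_fun n (\<xi> t \<omega>)) \<partial>N) = ennreal (prob {\<omega>\<in>space M. card (B t \<omega>) \<noteq> 1})" if t: "t \<ge> 0"
        unfolding prob_leaf_not_singleton[OF t]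
        using S.integrable_G_\<xi>[OF t, of 1 n] G_fun_bounds[OF S.\<xi>_nonneg[OF t], of _ 1 n]
        by (intro nn_integral_eq_integral) (auto simp: F_fun_G_fun)
      then show "(\<integral>\<^sup>+\<omega>. ennreal (F_fun n (\<xi> t \<omega>)) \<partial>N) * indicator {0..} t = ennreal (prob {\<omega>\<in>space M. card (B t \<omega>) \<noteq> 1}) * indicator {0..} t"
        by (simp add: indicator_def)
    qed
    finally show ?thesis by simp
  qed
  finally show ?thesis .
qed

lemma prob_exit_window:
  assumes "t \<ge> 0" "h \<ge> 0" and j: "j \<in> {2..n}"
  shows "prob {\<omega>\<in>space M. card (B t \<omega>) = j \<and> card (B (t + h) \<omega>) \<noteq> j} =
    (LINT \<omega>|N. (1 - exp (- h * phi \<beta> (real j - 1))) * real ((n - 1) choose (j - 1)) * G_fun n j (\<xi> t \<omega>))"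
proof -
  have th: "0 \<le> t + h" "t \<le> t + h" and j1: "j \<in> {1..n}" using assms by auto
  have diff: "{\<omega>\<in>space M. card (B t \<omega>) = j \<and> card (B (t + h) \<omega>) \<noteq> j} =
    {\<omega>\<in>space M. card (B t \<omega>) = j \<and> card (B t \<omega>) = j} - {\<omega>\<in>space M. card (B t \<omega>) = j \<and> card (B (t + h) \<omega>) = j}"
    by auto
  have "prob {\<omega>\<in>space M. card (B t \<omega>) = j \<and> card (B (t + h) \<omega>) \<noteq> j} =
      prob {\<omega>\<in>space M. card (B t \<omega>) = j \<and> card (B t \<omega>) = j} -
      prob {\<omega>\<in>space M. card (B t \<omega>) = j \<and> card (B (t + h) \<omega>) = j}"
    unfolding diff by (rule finite_measure_Diff[OF UX_pred[OF assms(1,1)] UX_pred[OF assms(1) th(1)]]) auto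
  also have "\<dots> = (1 - exp (- h * phi \<beta> (real j - 1))) * real ((n - 1) choose (j - 1)) * (LINT \<omega>|N. G_fun n j (\<xi> t \<omega>))"
  proof -
    let ?I = "real ((n - 1) choose (j - 1)) * (LINT \<omega>|N. G_fun n j (\<xi> t \<omega>))"
    have "prob {\<omega>\<in>space M. card (B t \<omega>) = j \<and> card (B t \<omega>) = j} = ?I"
      using prob_leaf_block_size[OF assms(1) order_refl j1] by (simp only: diff_self minus_zero mult_zero_left exp_zero mult_1_left)
    moreover have "prob {\<omega>\<in>space M. card (B t \<omega>) = j \<and> card (B (t + h) \<omega>) = j} = exp (- h * phi \<beta> (real j - 1)) * ?I"
      using prob_leaf_block_size[OF assms(1) th(2) j1] by (simp only: add_diff_cancel_left')
    ultimately show ?thesis by (simp only: left_diff_distrib mult_1_left mult.assoc)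
  qed
  finally show ?thesis by simp
qed

text \<open>By right-continuity, a size is visited if and only if it is seen at a rational time.\<close>

lemma visited_event: "{\<omega>\<in>space M. \<exists>t\<ge>0. card (B t \<omega>) = j} \<in> events"
proof -
  have "{\<omega>\<in>space M. \<exists>t\<ge>0. card (B t \<omega>) = j} = (\<Union>q\<in>\<rat> \<inter> {0..}. {\<omega>\<in>space M. card (B q \<omega>) = j})"
  proof (intro equalityI subsetI)
    fix \<omega> assume "\<omega> \<in> {\<omega>\<in>space M. \<exists>t\<ge>0. card (B t \<omega>) = j}"
    then obtain t where t: "\<omega> \<in> space M" "t \<ge> 0" "card (B t \<omega>) = j" by auto
    obtain q where "q \<in> \<rat>" "t < q" "q < t + 1" "B q \<omega> = B t \<omega>"
      using rational_right_of[OF B_right_continuous[OF t(2,1)], of "t + 1"] by auto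
    then show "\<omega> \<in> (\<Union>q\<in>\<rat> \<inter> {0..}. {\<omega>\<in>space M. card (B q \<omega>) = j})"
      using t by (intro UN_I[of q]) auto
  qed auto
  also have "\<dots> \<in> events"
    by (intro sets.countable_UN' countable_Int1 countable_rat) (auto intro: UX_pred)
  finally show ?thesis .
qed

text \<open>The expected time in the exit window of length \<open>h\<close> is computed exactly, divided by \<open>h\<close> and then
passed to the limit \<open>h \<rightarrow> 0\<close> along \<open>h = 1 / (m + 1)\<close>; the constant \<open>1\<close> dominates.\<close>

lemma clade_prob_eq_potential:
  assumes j: "j \<in> {2..n}"
  shows "ennreal (clade_prob M X U j) = ennreal (phi \<beta> (real j - 1) * real ((n - 1) choose (j - 1))) * potential N \<xi> (G_fun n j)"
proof -
  let ?\<phi> = "phi \<beta> (real j - 1)"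
  let ?C = "real ((n - 1) choose (j - 1))"
  let ?h = "\<lambda>m. 1 / real (Suc m)"
  let ?P = "\<lambda>m t \<omega>. card (B t \<omega>) = j \<and> card (B (t + ?h m) \<omega>) \<noteq> j"
  let ?c = "\<lambda>m. (1 - exp (- ?h m * ?\<phi>)) * ?C"
  have "1 \<le> j - 1" "1 \<le> j" using j by auto
  then have \<phi>: "?\<phi> > 0" using phi_pos[OF \<beta>, of "j - 1"] by (simp add: of_nat_diff)
  have rc: "\<forall>\<^sub>F s in at_right t. ?P m s \<omega> = ?P m t \<omega>" if "t \<ge> 0" "\<omega> \<in> space M" for m t \<omega>
  proof -
    have "\<forall>\<^sub>F s in at_right (t + ?h m). B s \<omega> = B (t + ?h m) \<omega>"
      using that by (intro B_right_continuous) auto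
    then have "\<forall>\<^sub>F s in at_right t. B (s + ?h m) \<omega> = B (t + ?h m) \<omega>"
      by (subst (asm) at_right_to_0, subst at_right_to_0) (simp add: eventually_filtermap add_ac)
    with B_right_continuous[OF that] show ?thesis by eventually_elim simp
  qed
  have ev: "{\<omega>\<in>space M. ?P m t \<omega>} \<in> events" if "t \<ge> 0" for m t
    using that by (intro UX_pred) auto
  define R where "R m \<omega> = ennreal (real (Suc m)) * (\<integral>\<^sup>+t\<in>{0..}. ennreal (of_bool (?P m t \<omega>)) \<partial>lborel)" for m \<omega>
  have Rm: "R m \<in> borel_measurable M" for m
    unfolding R_def using time_integral_prob(1)[of "?P m", OF rc ev] by measurable
  have lim: "(\<lambda>m. \<integral>\<^sup>+\<omega>. R m \<omega> \<partial>M) \<longlonglongrightarrow> (\<integral>\<^sup>+\<omega>. indicator {\<omega>\<in>space M. \<exists>t\<ge>0. card (B t \<omega>) = j} \<omega> \<partial>M)"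
  proof (rule nn_integral_dominated_convergence[where w = "\<lambda>_. 1"])
    show "AE \<omega> in M. R m \<omega> \<le> 1" for m
      using AE_refining
    proof eventually_elim
      case (elim \<omega>)
      show ?case unfolding R_def using refining.exit_window(2)[OF elim, of j m] j by simp
    qed
    show "AE \<omega> in M. (\<lambda>m. R m \<omega>) \<longlonglongrightarrow> indicator {\<omega>\<in>space M. \<exists>t\<ge>0. card (B t \<omega>) = j} \<omega>"
      using AE_refining AE_space
    proof eventually_elim
      case (elim \<omega>)
      have "indicator {j. \<exists>t\<ge>0. card (B t \<omega>) = j} j = (indicator {\<omega>\<in>space M. \<exists>t\<ge>0. card (B t \<omega>) = j} \<omega> :: ennreal)"
        using elim(2) by (simp add: indicator_def)
      then show ?case unfolding R_def using refining.exit_window(1)[OF elim(1), of j] j by simp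
    qed
  qed (use Rm visited_event in \<open>auto simp: emeasure_space_1\<close>)
  have R: "(\<integral>\<^sup>+\<omega>. R m \<omega> \<partial>M) = ennreal (real (Suc m) * (1 - exp (- ?h m * ?\<phi>)) * ?C) * potential N \<xi> (G_fun n j)" for m
  proof -
    have c0: "0 \<le> ?c m" using \<phi> by simp
    have "(\<integral>\<^sup>+\<omega>. R m \<omega> \<partial>M) = ennreal (real (Suc m)) * (\<integral>\<^sup>+\<omega>. (\<integral>\<^sup>+t\<in>{0..}. ennreal (of_bool (?P m t \<omega>)) \<partial>lborel) \<partial>M)"
      unfolding R_def by (rule nn_integral_cmult) (rule time_integral_prob(1)[of "?P m", OF rc ev])
    also have "(\<integral>\<^sup>+\<omega>. (\<integral>\<^sup>+t\<in>{0..}. ennreal (of_bool (?P m t \<omega>)) \<partial>lborel) \<partial>M) =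
      (\<integral>\<^sup>+t\<in>{0..}. ennreal (prob {\<omega>\<in>space M. ?P m t \<omega>}) \<partial>lborel)"
      by (rule time_integral_prob(2)[of "?P m", OF rc ev])
    also have "\<dots> = (\<integral>\<^sup>+t\<in>{0..}. (\<integral>\<^sup>+\<omega>. ennreal (?c m * G_fun n j (\<xi> t \<omega>)) \<partial>N) \<partial>lborel)"
    proof (intro nn_integral_cong)
      fix t :: real
      have "(\<integral>\<^sup>+\<omega>. ennreal (?c m * G_fun n j (\<xi> t \<omega>)) \<partial>N) = ennreal (prob {\<omega>\<in>space M. ?P m t \<omega>})" if t: "t \<ge> 0"
      proof -
        have "prob {\<omega>\<in>space M. ?P m t \<omega>} = (LINT \<omega>|N. ?c m * G_fun n j (\<xi> t \<omega>))"
          using t j by (intro prob_exit_window) auto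
        moreover have "integrable N (\<lambda>\<omega>. ?c m * G_fun n j (\<xi> t \<omega>))"
          using t j by (intro integrable_mult_right S.integrable_G_\<xi>) auto
        moreover have "AE \<omega> in N. 0 \<le> ?c m * G_fun n j (\<xi> t \<omega>)"
          using j G_fun_bounds[OF S.\<xi>_nonneg[OF t], of _ j n] by (intro AE_I2 mult_nonneg_nonneg[OF c0]) auto
        ultimately show ?thesis by (simp only: nn_integral_eq_integral)
      qed
      then show "ennreal (prob {\<omega>\<in>space M. ?P m t \<omega>}) * indicator {0..} t = (\<integral>\<^sup>+\<omega>. ennreal (?c m * G_fun n j (\<xi> t \<omega>)) \<partial>N) * indicator {0..} t"
        by (simp add: indicator_def)
    qed
    also have "\<dots> = potential N \<xi> (\<lambda>x. ?c m * G_fun n j x)"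
      by (rule S.potential_eq[symmetric]) (intro continuous_intros isCont_G_fun)
    also have "\<dots> = ennreal (?c m) * potential N \<xi> (G_fun n j)"
      by (rule S.potential_cmult[OF isCont_G_fun c0])
    finally have "(\<integral>\<^sup>+\<omega>. R m \<omega> \<partial>M) = (ennreal (real (Suc m)) * ennreal (?c m)) * potential N \<xi> (G_fun n j)"
      by (simp only: mult.assoc)
    also have "ennreal (real (Suc m)) * ennreal (?c m) = ennreal (real (Suc m) * ?c m)"
      by (rule ennreal_mult[symmetric]) (use c0 in auto)
    finally show ?thesis by (simp only: mult.assoc)
  qed
  have "(\<lambda>m. ennreal (real (Suc m) * (1 - exp (- ?h m * ?\<phi>)) * ?C) * potential N \<xi> (G_fun n j)) \<longlonglongrightarrow>
    ennreal (?\<phi> * ?C) * potential N \<xi> (G_fun n j)"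
  proof (rule tendsto_mult_ennreal[OF _ tendsto_const])
    show "(\<lambda>m. ennreal (real (Suc m) * (1 - exp (- ?h m * ?\<phi>)) * ?C)) \<longlonglongrightarrow> ennreal (?\<phi> * ?C)"
      by (intro tendsto_ennrealI tendsto_mult tendsto_const LIMSEQ_exit_rate)
    \<comment> \<open>The potential is not known to be finite at this point, so the limit of the product needs a nonzero factor.\<close>
    have "j - 1 \<le> n - 1" using j by auto
    then have "0 < ?C" by simp
    then have "ennreal (?\<phi> * ?C) \<noteq> 0" using \<phi> by (simp add: ennreal_eq_0_iff not_le)
    then show "\<not> (ennreal (?\<phi> * ?C) = 0 \<and> potential N \<xi> (G_fun n j) = \<infinity> \<or> ennreal (?\<phi> * ?C) = \<infinity> \<and> potential N \<xi> (G_fun n j) = 0)"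
      by simp
  qed
  from LIMSEQ_unique[OF lim[unfolded R] this] have "(\<integral>\<^sup>+\<omega>. indicator {\<omega>\<in>space M. \<exists>t\<ge>0. card (B t \<omega>) = j} \<omega> \<partial>M) = ennreal (?\<phi> * ?C) * potential N \<xi> (G_fun n j)"
    .
  then show ?thesis
    using visited_event[of j] by (simp add: clade_prob_def emeasure_eq_measure)
qed

lemma expectation_discrete_height:
  "(\<integral>\<^sup>+\<omega>. of_nat (discrete_height (\<lambda>t. X t \<omega>) (U \<omega>)) \<partial>M) = ennreal (\<Sum>j=2..n. clade_prob M X U j)"
proof -
  let ?D = "\<lambda>j. {\<omega>\<in>space M. \<exists>t\<ge>0. card (B t \<omega>) = j}"
  have "(\<integral>\<^sup>+\<omega>. of_nat (discrete_height (\<lambda>t. X t \<omega>) (U \<omega>)) \<partial>M) = (\<integral>\<^sup>+\<omega>. (\<Sum>j=2..n. indicator (?D j) \<omega>) \<partial>M)"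
  proof (rule nn_integral_cong_AE)
    show "AE \<omega> in M. of_nat (discrete_height (\<lambda>t. X t \<omega>) (U \<omega>)) = (\<Sum>j=2..n. indicator (?D j) \<omega> :: ennreal)"
      using AE_refining AE_space
    proof eventually_elim
      case (elim \<omega>)
      have "(\<Sum>j=2..n. indicator (?D j) \<omega> :: ennreal) = (\<Sum>j\<in>{j\<in>{2..n}. \<exists>t\<ge>0. card (B t \<omega>) = j}. 1)"
        using elim(2) by (intro sum.mono_neutral_cong_right) (auto simp: indicator_def)
      then show ?case unfolding refining.discrete_height_eq[OF elim(1)] by simp
    qed
  qed
  also have "\<dots> = (\<Sum>j=2..n. ennreal (clade_prob M X U j))"
    using visited_event by (subst nn_integral_sum) (auto simp: clade_prob_def emeasure_eq_measure)
  also have "\<dots> = ennreal (\<Sum>j=2..n. clade_prob M X U j)"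
    by (rule sum_ennreal) (simp add: clade_prob_def)
  finally show ?thesis .
qed

text \<open>The expected number of blocks is the sum of the probabilities of being a block, and there are
\<open>n choose j\<close> candidates of size \<open>j\<close>.\<close>

lemma expectation_nonsingletons:
  assumes t: "t \<ge> 0"
  shows "(\<integral>\<^sup>+\<omega>. ennreal (real (card {A\<in>X t \<omega>. card A \<noteq> 1})) \<partial>M) = (\<integral>\<^sup>+\<omega>. ennreal (H_fun n (\<xi> t \<omega>)) \<partial>N)"
proof -
  let ?K = "{V. V \<subseteq> {1..n} \<and> 2 \<le> card V}"
  have finK: "finite ?K" by (rule finite_subset[of _ "Pow {1..n}"]) auto
  have "(\<integral>\<^sup>+\<omega>. ennreal (real (card {A\<in>X t \<omega>. card A \<noteq> 1})) \<partial>M) =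
    (\<integral>\<^sup>+\<omega>. (\<Sum>V\<in>?K. indicator {\<omega>\<in>space M. V \<in> X t \<omega>} \<omega>) \<partial>M)"
  proof (rule nn_integral_cong)
    fix \<omega> assume \<omega>: "\<omega> \<in> space M"
    have part: "A \<subseteq> {1..n} \<and> A \<noteq> {}" if "A \<in> X t \<omega>" for A
      using X_in[OF t \<omega>] that by (auto simp: label_partitions_def partition_on_def)
    have "card A \<noteq> 1 \<longleftrightarrow> 2 \<le> card A" if "A \<in> X t \<omega>" for A
    proof -
      have "card A \<noteq> 0" using part[OF that] finite_subset[of A "{1..n}"] by auto
      then show ?thesis by auto
    qed
    then have "{A\<in>X t \<omega>. card A \<noteq> 1} = {V\<in>?K. V \<in> X t \<omega>}" using part by auto
    moreover have "(\<Sum>V\<in>?K. indicator {\<omega>\<in>space M. V \<in> X t \<omega>} \<omega> :: ennreal) = (\<Sum>V\<in>{V\<in>?K. V \<in> X t \<omega>}. 1)"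
      using \<omega> finK by (intro sum.mono_neutral_cong_right) (auto simp: indicator_def)
    ultimately show "ennreal (real (card {A\<in>X t \<omega>. card A \<noteq> 1})) = (\<Sum>V\<in>?K. indicator {\<omega>\<in>space M. V \<in> X t \<omega>} \<omega>)"
      by (simp add: ennreal_of_nat_eq_real_of_nat)
  qed
  also have "\<dots> = (\<Sum>V\<in>?K. ennreal (prob {\<omega>\<in>space M. V \<in> X t \<omega>}))"
    using X_pred[OF t] by (subst nn_integral_sum) (auto simp: emeasure_eq_measure)
  also have "\<dots> = (\<Sum>V\<in>?K. ennreal (LINT \<omega>|N. G_fun n (card V) (\<xi> t \<omega>)))"
    using t by (intro sum.cong refl arg_cong[where f = ennreal] prob_block_G) auto
  also have "\<dots> = (\<Sum>j\<in>{2..n}. \<Sum>V\<in>{V\<in>?K. card V = j}. ennreal (LINT \<omega>|N. G_fun n (card V) (\<xi> t \<omega>)))"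
  proof (rule sum.group[symmetric])
    show "card ` ?K \<subseteq> {2..n}" using card_mono[of "{1..n}"] by fastforce
  qed (use finK in auto)
  also have "\<dots> = (\<Sum>j\<in>{2..n}. \<integral>\<^sup>+\<omega>. ennreal (real (n choose j) * G_fun n j (\<xi> t \<omega>)) \<partial>N)"
  proof (intro sum.cong refl)
    fix j assume j: "j \<in> {2..n}"
    have "(\<Sum>V\<in>{V\<in>?K. card V = j}. ennreal (LINT \<omega>|N. G_fun n (card V) (\<xi> t \<omega>))) =
      (\<Sum>V\<in>{V. V \<subseteq> {1..n} \<and> card V = j}. ennreal (LINT \<omega>|N. G_fun n j (\<xi> t \<omega>)))"
      using j by (intro sum.cong) auto
    also have "\<dots> = ennreal (real (n choose j)) * (\<integral>\<^sup>+\<omega>. ennreal (G_fun n j (\<xi> t \<omega>)) \<partial>N)"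
      using n_subsets[of "{1..n}" j] S.nn_integral_G_\<xi>[OF t, of j n] j
      by (simp add: ennreal_of_nat_eq_real_of_nat)
    also have "\<dots> = (\<integral>\<^sup>+\<omega>. ennreal (real (n choose j)) * ennreal (G_fun n j (\<xi> t \<omega>)) \<partial>N)"
      using S.\<xi>_measurable[OF t] by (intro nn_integral_cmult[symmetric]) measurable
    also have "\<dots> = (\<integral>\<^sup>+\<omega>. ennreal (real (n choose j) * G_fun n j (\<xi> t \<omega>)) \<partial>N)"
      by (simp add: ennreal_mult')
    finally show "(\<Sum>V\<in>{V\<in>?K. card V = j}. ennreal (LINT \<omega>|N. G_fun n (card V) (\<xi> t \<omega>))) = \<dots>" .
  qed
  also have "\<dots> = (\<integral>\<^sup>+\<omega>. (\<Sum>j\<in>{2..n}. ennreal (real (n choose j) * G_fun n j (\<xi> t \<omega>))) \<partial>N)"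
    using S.\<xi>_measurable[OF t] by (intro nn_integral_sum[symmetric]) measurable
  also have "\<dots> = (\<integral>\<^sup>+\<omega>. ennreal (H_fun n (\<xi> t \<omega>)) \<partial>N)"
    using G_fun_bounds[OF S.\<xi>_nonneg[OF t], of _ _ n] n
    by (intro nn_integral_cong) (subst sum_ennreal, auto simp: H_fun_eq_sum_G_fun)
  finally show ?thesis .
qed

lemma expectation_total_length:
  "(\<integral>\<^sup>+\<omega>. total_length (\<lambda>t. X t \<omega>) \<partial>M) = potential N \<xi> (H_fun n)"
proof -
  let ?g = "\<lambda>t \<omega>. real (card {A\<in>X t \<omega>. card A \<noteq> 1})"
  have "(\<integral>\<^sup>+\<omega>. total_length (\<lambda>t. X t \<omega>) \<partial>M) = (\<integral>\<^sup>+\<omega>. (\<integral>\<^sup>+t\<in>{0..}. ennreal (?g t \<omega>) \<partial>lborel) \<partial>M)"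
    by (simp add: total_length_def ennreal_of_nat_eq_real_of_nat)
  also have "\<dots> = (\<integral>\<^sup>+t\<in>{0..}. (\<integral>\<^sup>+\<omega>. ennreal (?g t \<omega>) \<partial>M) \<partial>lborel)"
  proof (rule nn_integral_time_swap)
    show "?g t \<in> borel_measurable M" if "t \<ge> 0" for t
      by (rule measurable_compose[OF X_measurable[OF that]]) simp
    show "((\<lambda>s. ?g s \<omega>) \<longlongrightarrow> ?g t \<omega>) (at_right t)" if "t \<ge> 0" "\<omega> \<in> space M" for t \<omega>
      using X_right_continuous[OF that] by (intro tendsto_eventually) (auto elim: eventually_mono)
  qed (rule sigma_finite_measure_axioms)
  also have "\<dots> = (\<integral>\<^sup>+t\<in>{0..}. (\<integral>\<^sup>+\<omega>. ennreal (H_fun n (\<xi> t \<omega>)) \<partial>N) \<partial>lborel)"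
    using expectation_nonsingletons by (intro nn_integral_cong) (simp add: indicator_def)
  also have "\<dots> = potential N \<xi> (H_fun n)"
    by (rule S.potential_eq[symmetric]) (unfold H_fun_def, intro continuous_intros)
  finally show ?thesis .
qed

lemma same_law_passage_time:
  assumes n2: "n \<ge> 2"
    and E: "\<And>i. i \<in> {1..n-1} \<Longrightarrow> distributed N lborel (E i) (\<lambda>x. ennreal (exponential_density 1 x))"
    and indep: "S.indep_vars (\<lambda>_. borel) E {1..n-1}"
    and ind: "indep_elements N borel (\<lambda>\<omega>. Max ((\<lambda>i. E i \<omega>) ` {1..n-1}))
          (\<Pi>\<^sub>M t\<in>{0..}. borel) (\<lambda>\<omega>. \<lambda>t\<in>{0..}. \<xi> t \<omega>)"
  shows "same_law M (\<lambda>\<omega>. cont_height (\<lambda>t. X t \<omega>) (U \<omega>))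
          N (\<lambda>\<omega>. passage_time (\<lambda>t. \<xi> t \<omega>) (Max ((\<lambda>i. E i \<omega>) ` {1..n-1})))"
proof -
  have Y: "(\<lambda>\<omega>. Max ((\<lambda>i. E i \<omega>) ` {1..n-1})) \<in> borel_measurable N"
    using ind by (simp add: indep_elements_def)
  have "prob {\<omega>\<in>space M. ennreal t < cont_height (\<lambda>s. X s \<omega>) (U \<omega>)} =
    S.prob {\<omega>\<in>space N. ennreal t < passage_time (\<lambda>t. \<xi> t \<omega>) (Max ((\<lambda>i. E i \<omega>) ` {1..n-1}))}" if t: "t \<ge> 0" for t
  proof -
    have "{\<omega>\<in>space N. ennreal t < passage_time (\<lambda>t. \<xi> t \<omega>) (Max ((\<lambda>i. E i \<omega>) ` {1..n-1}))} =
      {\<omega>\<in>space N. \<xi> t \<omega> < Max ((\<lambda>i. E i \<omega>) ` {1..n-1})}"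
      using S.less_passage_time_iff[OF t] by blast
    then show ?thesis
      using prob_less_cont_height[OF t] S.prob_less_Max_exponential[OF n2 t E indep ind] by simp
  qed
  then show ?thesis
    unfolding same_law_def
    using cont_height_measurable S.passage_time_measurable[OF Y]
    by (intro conjI distr_ennreal_eqI prob_space_axioms S.prob_space_axioms)
qed

end

theorem theorem2p1:
  fixes \<beta> :: real and n :: nat
    and M :: "'w measure" and X :: "real \<Rightarrow> 'w \<Rightarrow> nat set set" and U :: "'w \<Rightarrow> nat"
    and N :: "'v measure" and \<xi> :: "real \<Rightarrow> 'v \<Rightarrow> real"
  assumes "\<beta> > -2" and "n \<ge> 2"
    and "beta_splitting_tree \<beta> n M X"
    and "uniform_leaf n M X U"
    and "beta_subordinator \<beta> N \<xi>"
  shows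
    "((\<forall>t\<ge>0. measure M {\<omega>\<in>space M. ennreal t < cont_height (\<lambda>s. X s \<omega>) (U \<omega>)} =
              (LINT \<omega>|N. F_fun n (\<xi> t \<omega>))) \<and>
      (\<integral>\<^sup>+\<omega>. cont_height (\<lambda>t. X t \<omega>) (U \<omega>) \<partial>M) = potential N \<xi> (F_fun n) \<and>
      (\<integral>\<^sup>+\<omega>. total_length (\<lambda>t. X t \<omega>) \<partial>M) = potential N \<xi> (H_fun n)) \<and>
     ((\<integral>\<^sup>+\<omega>. of_nat (discrete_height (\<lambda>t. X t \<omega>) (U \<omega>)) \<partial>M) =
        ennreal (\<Sum>j=2..n. clade_prob M X U j) \<and>
      (\<forall>j\<in>{2..n}. ennreal (clade_prob M X U j) =
        ennreal (phi \<beta> (real j - 1) * real ((n - 1) choose (j - 1))) * potential N \<xi> (G_fun n j))) \<and>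
     (\<forall>E :: nat \<Rightarrow> 'v \<Rightarrow> real.
        (\<forall>i\<in>{1..n-1}. distributed N lborel (E i) (\<lambda>x. ennreal (exponential_density 1 x))) \<and>
        prob_space.indep_vars N (\<lambda>_. borel) E {1..n-1} \<and>
        indep_elements N borel (\<lambda>\<omega>. Max ((\<lambda>i. E i \<omega>) ` {1..n-1}))
          (\<Pi>\<^sub>M t\<in>{0..}. borel) (\<lambda>\<omega>. \<lambda>t\<in>{0..}. \<xi> t \<omega>) \<longrightarrow>
        same_law M (\<lambda>\<omega>. cont_height (\<lambda>t. X t \<omega>) (U \<omega>))
          N (\<lambda>\<omega>. passage_time (\<lambda>t. \<xi> t \<omega>) (Max ((\<lambda>i. E i \<omega>) ` {1..n-1}))))"
proof -
  have "prob_space M" using assms(3) by (simp add: beta_splitting_tree_def finite_ctmc_def)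
  moreover have "prob_space N" using assms(5) by (simp add: beta_subordinator_def subordinator_def)
  ultimately interpret beta_tree_sub M \<beta> n X U N \<xi>
    using assms
    by (simp add: beta_tree_sub_def beta_tree_leaf_def beta_tree_def beta_tree_axioms_def
        beta_tree_leaf_axioms_def beta_sub_def beta_sub_axioms_def)
  show ?thesis
    using prob_less_cont_height expectation_cont_height expectation_total_length
      expectation_discrete_height clade_prob_eq_potential same_law_passage_time[OF assms(2)]
    by blast
qed

end
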